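(* Consider the single-stage Stackelberg signaling game described in the context, with $\theta>0$ and $b\in\mathbb R$. The only Stackelberg equilibrium (affine or not) is the linear equilibrium with $\gamma^e({\bf x})=A{\bf x}$ and $\gamma^d({\bf r})=K{\bf r}$ with $A\ge 0$ and $K\ge 0$. In particular, at the equilibrium, the encoder cost is $$J^{e,*}=J^{d,*}+\theta A^2\sigma_{\bf x}^2+b^2,$$ where $A\ge0$ is determined by $$A^2=\begin{cases}\sqrt{\dfrac{\sigma_{\bf v}^2}{\theta\sigma_{\bf x}^2}}-\dfrac{\sigma_{\bf v}^2}{\sigma_{\bf x}^2}\left(\dfrac{\sigma_{\bf x}^2}{\sigma_{\bf w}^2}+1\right), & \text{if } \theta<\dfrac{\sigma_{\bf x}^2}{\sigma_{\bf v}^2\left(\frac{\sigma_{\bf x}^2}{\sigma_{\bf w}^2}+1\right)^2},\\[3ex] 0, & \text{if } \theta\ge\dfrac{\sigma_{\bf x}^2}{\sigma_{\bf v}^2\left(\frac{\sigma_{\bf x}^2}{\sigma_{\bf w}^2}+1\right)^2},\end{cases}$$ and the corresponding decoder quantities are $$\alpha=\frac{A\sigma_{\bf w}^2}{A\sigma_{\bf w}^2+\sigma_{\bf v}^2},\quad K=\frac{A\sigma_{\bf x}^2\sigma_{\bf w}^2+\sigma_{\bf x}^2\sigma_{\bf v}^2}{A^2\sigma_{\bf x}^2\sigma_{\bf w}^2+\sigma_{\bf x}^2\sigma_{\bf v}^2+\sigma_{\bf w}^2\sigma_{\bf v}^2},\quad J^{d,*}=\frac{\sigma_{\bf x}^2\sigma_{\bf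 w}^2\sigma_{\bf v}^2}{(A^2\sigma_{\bf w}^2+\sigma_{\bf v}^2)\sigma_{\bf x}^2+\sigma_{\bf w}^2\sigma_{\bf v}^2}.$$
   Context: Setting: ${\bf x}\sim\mathcal N(0,\sigma_{\bf x}^2)$, ${\bf v}\sim\mathcal N(0,\sigma_{\bf v}^2)$, ${\bf w}\sim\mathcal N(0,\sigma_{\bf w}^2)$ are independent with positive variances. The encoder observes ${\bf x}$ and sends ${\bf m}=\gamma^e({\bf x})$ ($\gamma^e$ measurable, ${\bf E}[{\bf m}^2]<\infty$). The decoder's strategy consists of a channel combining parameter $\alpha\in[0,1]$ (a deterministic number) together with a measurable function $\gamma^d$; it receives ${\bf r}=\alpha({\bf m}+{\bf v})+(1-\alpha)({\bf x}+{\bf w})$ and outputs $\hat{\bf x}=\gamma^d({\bf r})$. Strategies are identified when they agree almost surely. Costs: the encoder minimizes $J^e={\bf E}[({\bf x}-\hat{\bf x}-b)^2+\theta(\gamma^e({\bf x}))^2]$ and the decoder minimizes $J^d={\bf E}[({\bf x}-\hat{\bf x})^2]$, where the bias $b$ and the soft power coefficient $\theta$ are known to both players. Stackelberg equilibrium (encoder is leader, decoder is follower): the encoder commits to and announces $\gamma^e$; the decoder responds with a strategy $\gamma^{d,*}(\gamma^e)$ (including the choice of $\alpha$) minimizing $J^d(\gamma^e,\cdot)$. A pair $(\gamma^{e,*},\gamma^{d,*})$ is a Stackelberg equilibrium if $J^e(\gamma^{e,*},\gamma^{d,*}(\gamma^{e,*}))\le J^e(\gamma^e,\gamma^{d,*}(\gamma^e))$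 for all encoder strategies $\gamma^e$, where $\gamma^{d,*}(\gamma^e)$ satisfies $J^d(\gamma^e,\gamma^{d,*}(\gamma^e))\le J^d(\gamma^e,\gamma^d)$ for all decoder strategies $\gamma^d$. $J^{e,*}$ and $J^{d,*}$ denote the costs at equilibrium. *)

theory Defs
  imports "HOL-Probability.Probability"
begin

text \<open>
  \<open>M\<close> is the underlying probability space; \<open>x\<close>, \<open>v\<close>, \<open>w\<close> are the source, the channel noise
  and the noise of the decoder's side observation. A decoder strategy is a pair of the
  (deterministic) combining parameter and the estimator.
\<close>

type_synonym encoder = "real \<Rightarrow> real"
type_synonym decoder = "real \<times> (real \<Rightarrow> real)"

definition encoder_strategy :: "'a measure \<Rightarrow> ('a \<Rightarrow> real) \<Rightarrow> encoder \<Rightarrow> bool" where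
  "encoder_strategy M x \<gamma>e \<longleftrightarrow>
     \<gamma>e \<in> borel_measurable borel \<and> integrable M (\<lambda>\<omega>. (\<gamma>e (x \<omega>))\<^sup>2)"

definition decoder_strategy :: "decoder \<Rightarrow> bool" where
  "decoder_strategy d \<longleftrightarrow> fst d \<in> {0..1} \<and> snd d \<in> borel_measurable borel"

definition received ::
  "('a \<Rightarrow> real) \<Rightarrow> ('a \<Rightarrow> real) \<Rightarrow> ('a \<Rightarrow> real) \<Rightarrow> encoder \<Rightarrow> real \<Rightarrow> 'a \<Rightarrow> real" where
  "received x v w \<gamma>e \<alpha> \<omega> = \<alpha> * (\<gamma>e (x \<omega>) + v \<omega>) + (1 - \<alpha>) * (x \<omega> + w \<omega>)"

definition estimate ::
  "('a \<Rightarrow> real) \<Rightarrow> ('a \<Rightarrow> real) \<Rightarrow> ('a \<Rightarrow> real) \<Rightarrow> encoder \<Rightarrow> decoder \<Rightarrow> 'a \<Rightarrow> real" where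
  "estimate x v w \<gamma>e d \<omega> = snd d (received x v w \<gamma>e (fst d) \<omega>)"

text \<open>
  The costs are expectations of nonnegative quantities (for \<open>\<theta> \<ge> 0\<close>) and are taken in
  \<open>[0, \<infinity>]\<close>: estimators need not be square integrable, and the Bochner integral would assign
  such an estimator cost 0.
\<close>

definition encoder_cost ::
  "'a measure \<Rightarrow> ('a \<Rightarrow> real) \<Rightarrow> ('a \<Rightarrow> real) \<Rightarrow> ('a \<Rightarrow> real) \<Rightarrow> real \<Rightarrow> real
     \<Rightarrow> encoder \<Rightarrow> decoder \<Rightarrow> ennreal" where
  "encoder_cost M x v w \<theta> b \<gamma>e d =
     (\<integral>\<^sup>+ \<omega>. ennreal ((x \<omega> - estimate x v w \<gamma>e d \<omega> - b)\<^sup>2 + \<theta> * (\<gamma>e (x \<omega>))\<^sup>2) \<partial>M)"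

definition decoder_cost ::
  "'a measure \<Rightarrow> ('a \<Rightarrow> real) \<Rightarrow> ('a \<Rightarrow> real) \<Rightarrow> ('a \<Rightarrow> real) \<Rightarrow> encoder \<Rightarrow> decoder \<Rightarrow> ennreal" where
  "decoder_cost M x v w \<gamma>e d = (\<integral>\<^sup>+ \<omega>. ennreal ((x \<omega> - estimate x v w \<gamma>e d \<omega>)\<^sup>2) \<partial>M)"

definition best_response ::
  "'a measure \<Rightarrow> ('a \<Rightarrow> real) \<Rightarrow> ('a \<Rightarrow> real) \<Rightarrow> ('a \<Rightarrow> real) \<Rightarrow> encoder \<Rightarrow> decoder \<Rightarrow> bool" where
  "best_response M x v w \<gamma>e d \<longleftrightarrow>
     decoder_strategy d \<and>
     (\<forall>d'. decoder_strategy d' \<longrightarrow> decoder_cost M x v w \<gamma>e d \<le> decoder_cost M x v w \<gamma>e d')"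

text \<open>
  The follower's component of a Stackelberg equilibrium is a reaction rule \<open>R\<close>, giving a
  response to every announced encoder strategy; the strategy played is \<open>R \<gamma>e\<close>.
\<close>

definition stackelberg_equilibrium ::
  "'a measure \<Rightarrow> ('a \<Rightarrow> real) \<Rightarrow> ('a \<Rightarrow> real) \<Rightarrow> ('a \<Rightarrow> real) \<Rightarrow> real \<Rightarrow> real
     \<Rightarrow> encoder \<Rightarrow> (encoder \<Rightarrow> decoder) \<Rightarrow> bool" where
  "stackelberg_equilibrium M x v w \<theta> b \<gamma>e R \<longleftrightarrow>
     encoder_strategy M x \<gamma>e \<and>
     (\<forall>g. encoder_strategy M x g \<longrightarrow> best_response M x v w g (R g)) \<and>
     (\<forall>g. encoder_strategy M x g \<longrightarrow>
        encoder_cost M x v w \<theta> b \<gamma>e (R \<gamma>e) \<le> encoder_cost M x v w \<theta> b g (R g))"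

end

theory Submission
  imports Defs
begin

text \<open>
  A best response has an error of mean zero, since its estimator can be shifted by a constant
  (\<open>best_response_unbiased\<close>). Hence the bias enters the leader's cost only as \<open>b\<^sup>2\<close>, and the leader
  minimizes distortion plus \<open>\<theta>\<close> times power.

  The core is a lower bound for the distortion in terms of the power alone. For a fixed combining
  parameter the decoder observes the source through a single Gaussian channel, and no encoder of
  power \<open>P\<close> leads to an error below \<open>\<sigma>x\<^sup>2 / (1 + P / \<sigma>v\<^sup>2 + \<sigma>x\<^sup>2 / \<sigma>w\<^sup>2)\<close>. Behind this is the comparison of the rate
  distortion function with the capacity, which reduces to \<open>1 + l \<le> exp l\<close> for the logarithm \<open>l\<close>
  of a ratio of two joint densities (\<open>gaussian_channel_distortion_bound\<close>), combined with the
  Cauchy-Schwarz inequality for the power of \<open>\<alpha> m + (1 - \<alpha>) x\<close> (\<open>distortion_bound\<close>). Lagrange's form of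
  the latter keeps the defect, so equality makes the message a nonnegative multiple of the source
  and ties the combining parameter to it (\<open>mse_bound_tight_imp_linear\<close>). Conversely linear encoders meet the
  bound with a linear decoder (\<open>linear_mse\<close>).

  The leader's problem is thereby the minimization of a strictly convex function of the power
  (\<open>power_distortion_tradeoff\<close>). At any equilibrium the leader does at least as well as with the
  optimal linear encoder, so all bounds are attained and the encoder, the combining parameter and
  the estimator are determined (\<open>equilibrium_is_linear\<close>).

  For the existence of an equilibrium the follower must have a best response to every encoder,
  not only to linear ones. For each combining parameter it is the posterior mean, which depends
  continuously on the parameter; by Fatou's lemma the optimal cost is lower semicontinuous and
  attains its minimum on the compact interval (\<open>best_response_exists\<close>).
\<close>

section \<open>The additive Gaussian channel\<close>

text \<open>
  Conditionally on the source the output of the channel has a Gaussian density. Only the law of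
  the noise enters, so the source is left as an integral over \<open>M\<close>; later the order of the two
  integrals is exchanged in order to argue separately for each channel output.
\<close>

lemma (in prob_space) nn_integral_gaussian_channel:
  fixes X Z :: "'a \<Rightarrow> real" and F :: "real \<Rightarrow> real \<Rightarrow> ennreal"
  assumes indep: "indep_var borel X borel Z"
    and Z: "distributed M lborel Z (normal_density 0 \<tau>)"
    and s[measurable]: "s \<in> borel_measurable borel"
    and F[measurable]: "(\<lambda>(t, y). F t y) \<in> borel_measurable (borel \<Otimes>\<^sub>M borel)"
  shows "(\<integral>\<^sup>+\<omega>. F (X \<omega>) (s (X \<omega>) + Z \<omega>) \<partial>M) =
    (\<integral>\<^sup>+\<omega>. \<integral>\<^sup>+y. F (X \<omega>) y * ennreal (normal_density (s (X \<omega>)) \<tau> y) \<partial>lborel \<partial>M)"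
proof -
  have X[measurable]: "X \<in> borel_measurable M" and Zm[measurable]: "Z \<in> borel_measurable M"
    using indep by (auto dest: indep_var_rv1 indep_var_rv2)
  interpret DZ: prob_space "distr M borel Z" by (rule prob_space_distr) simp
  have Zdens: "(\<integral>\<^sup>+z. g z \<partial>distr M borel Z) = (\<integral>\<^sup>+z. ennreal (normal_density 0 \<tau> z) * g z \<partial>lborel)"
    if [measurable]: "g \<in> borel_measurable borel" for g
    by (simp add: nn_integral_distr distributed_nn_integral[OF Z, of g])
  have joint: "distr M (borel \<Otimes>\<^sub>M borel) (\<lambda>\<omega>. (X \<omega>, Z \<omega>)) = distr M borel X \<Otimes>\<^sub>M distr M borel Z"
    using indep by (simp add: indep_var_distribution_eq)
  have "(\<integral>\<^sup>+\<omega>. F (X \<omega>) (s (X \<omega>) + Z \<omega>) \<partial>M) =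
      (\<integral>\<^sup>+p. F (fst p) (s (fst p) + snd p) \<partial>distr M (borel \<Otimes>\<^sub>M borel) (\<lambda>\<omega>. (X \<omega>, Z \<omega>)))"
    by (subst nn_integral_distr) simp_all
  also have "\<dots> = (\<integral>\<^sup>+t. \<integral>\<^sup>+z. F t (s t + z) \<partial>distr M borel Z \<partial>distr M borel X)"
    unfolding joint by (subst DZ.nn_integral_fst[symmetric]) simp_all
  also have "\<dots> = (\<integral>\<^sup>+t. \<integral>\<^sup>+z. ennreal (normal_density 0 \<tau> z) * F t (s t + z) \<partial>lborel \<partial>distr M borel X)"
    by (rule nn_integral_cong, rule Zdens) simp
  also have "\<dots> = (\<integral>\<^sup>+t. \<integral>\<^sup>+y. F t y * ennreal (normal_density (s t) \<tau> y) \<partial>lborel \<partial>distr M borel X)"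
  proof (rule nn_integral_cong)
    fix t
    have "(\<integral>\<^sup>+y. F t y * ennreal (normal_density (s t) \<tau> y) \<partial>lborel) =
      (\<integral>\<^sup>+z. F t (s t + z) * ennreal (normal_density (s t) \<tau> (s t + z)) \<partial>lborel)"
      by (subst nn_integral_real_affine[where c = 1 and t = "s t"])
        (simp_all add: normal_density_def)
    then show "(\<integral>\<^sup>+z. ennreal (normal_density 0 \<tau> z) * F t (s t + z) \<partial>lborel) =
        (\<integral>\<^sup>+y. F t y * ennreal (normal_density (s t) \<tau> y) \<partial>lborel)"
      by (simp add: normal_density_def mult.commute)
  qed
  also have "\<dots> = (\<integral>\<^sup>+\<omega>. \<integral>\<^sup>+y. F (X \<omega>) y * ennreal (normal_density (s (X \<omega>)) \<tau> y) \<partial>lborel \<partial>M)"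
    by (subst nn_integral_distr) (simp_all add: normal_density_def)
  finally show ?thesis .
qed

lemma (in prob_space)
  assumes \<sigma>: "0 < \<sigma>" and X: "distributed M lborel X (normal_density 0 \<sigma>)"
  shows centered_normal_integrable: "integrable M X"
    and centered_normal_integrable_square: "integrable M (\<lambda>\<omega>. (X \<omega>)\<^sup>2)"
    and centered_normal_second_moment: "(\<integral>\<omega>. (X \<omega>)\<^sup>2 \<partial>M) = \<sigma>\<^sup>2"
proof -
  have [measurable]: "X \<in> borel_measurable M"
    using X by (simp add: distributed_def)
  show sq: "integrable M (\<lambda>\<omega>. (X \<omega>)\<^sup>2)"
    using integrable_normal_moment[OF \<sigma>, of 0 2]
    by (subst distributed_integrable[OF X, of "\<lambda>t. t\<^sup>2", symmetric]) auto
  show "integrable M X"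
    by (rule square_integrable_imp_integrable) (use sq in auto)
  have "expectation X = 0"
    by (rule normal_distributed_expectation[OF \<sigma> X])
  then show "(\<integral>\<omega>. (X \<omega>)\<^sup>2 \<partial>M) = \<sigma>\<^sup>2"
    using normal_distributed_variance[OF \<sigma> X] by simp
qed

lemma integrable_mult_of_squares:
  fixes f g :: "'a \<Rightarrow> real"
  assumes [measurable]: "f \<in> borel_measurable M" "g \<in> borel_measurable M"
    and "integrable M (\<lambda>\<omega>. (f \<omega>)\<^sup>2)" "integrable M (\<lambda>\<omega>. (g \<omega>)\<^sup>2)"
  shows "integrable M (\<lambda>\<omega>. f \<omega> * g \<omega>)"
proof (rule Bochner_Integration.integrable_bound)
  show "integrable M (\<lambda>\<omega>. (f \<omega>)\<^sup>2 + (g \<omega>)\<^sup>2)"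
    using assms by simp
  show "AE \<omega> in M. norm (f \<omega> * g \<omega>) \<le> norm ((f \<omega>)\<^sup>2 + (g \<omega>)\<^sup>2)"
  proof (rule AE_I2)
    fix \<omega>
    have "2 * (\<bar>f \<omega>\<bar> * \<bar>g \<omega>\<bar>) \<le> (f \<omega>)\<^sup>2 + (g \<omega>)\<^sup>2"
      using zero_le_power2[of "\<bar>f \<omega>\<bar> - \<bar>g \<omega>\<bar>"] by (simp add: power2_diff)
    then show "norm (f \<omega> * g \<omega>) \<le> norm ((f \<omega>)\<^sup>2 + (g \<omega>)\<^sup>2)"
      using mult_nonneg_nonneg[OF abs_ge_zero[of "f \<omega>"] abs_ge_zero[of "g \<omega>"]]
      by (simp only: abs_mult real_norm_def)
  qed
qed simp

text \<open>
  Let \<open>p\<close> be the joint density of source and output, and let \<open>q\<close> be the joint density of a fictitious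
  pair whose output is \<open>N(0, \<rho>\<^sup>2)\<close> and whose source, given the output \<open>y\<close>, is \<open>N(h y, \<delta>\<^sup>2)\<close>. The
  exponent below is \<open>ln (q / p)\<close>: the condition \<open>\<delta> * \<rho> = \<sigma> * \<tau>\<close> says precisely that the normalizing
  constants of \<open>p\<close> and \<open>q\<close> cancel. The expectation of \<open>q / p\<close> is the total mass of \<open>q\<close>.
\<close>

lemma (in prob_space) gaussian_channel_relative_density:
  fixes X Z :: "'a \<Rightarrow> real"
  assumes \<sigma>: "0 < \<sigma>" and X: "distributed M lborel X (normal_density 0 \<sigma>)"
    and \<tau>: "0 < \<tau>" and Z: "distributed M lborel Z (normal_density 0 \<tau>)"
    and indep: "indep_var borel X borel Z"
    and s[measurable]: "s \<in> borel_measurable borel"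
    and h[measurable]: "h \<in> borel_measurable borel"
    and \<delta>: "0 < \<delta>" and \<rho>: "0 < \<rho>" and balance: "\<delta> * \<rho> = \<sigma> * \<tau>"
  shows "(\<integral>\<^sup>+\<omega>. ennreal (exp ((X \<omega>)\<^sup>2 / (2 * \<sigma>\<^sup>2) + (Z \<omega>)\<^sup>2 / (2 * \<tau>\<^sup>2)
            - (X \<omega> - h (s (X \<omega>) + Z \<omega>))\<^sup>2 / (2 * \<delta>\<^sup>2)
            - (s (X \<omega>) + Z \<omega>)\<^sup>2 / (2 * \<rho>\<^sup>2))) \<partial>M) = 1"
proof -
  define L where "L t y = exp (t\<^sup>2 / (2 * \<sigma>\<^sup>2) + (y - s t)\<^sup>2 / (2 * \<tau>\<^sup>2)
      - (t - h y)\<^sup>2 / (2 * \<delta>\<^sup>2) - y\<^sup>2 / (2 * \<rho>\<^sup>2))" for t y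
  have [measurable]: "(\<lambda>(t, y). L t y) \<in> borel_measurable (borel \<Otimes>\<^sub>M borel)"
    unfolding L_def by measurable
  have norm: "sqrt (2 * pi * \<delta>\<^sup>2) * sqrt (2 * pi * \<rho>\<^sup>2) = sqrt (2 * pi * \<sigma>\<^sup>2) * sqrt (2 * pi * \<tau>\<^sup>2)"
    using \<sigma> \<tau> \<delta> \<rho> balance by (simp add: real_sqrt_mult algebra_simps)
  \<comment> \<open>\<open>L\<close> is the ratio of the fictitious joint density to the true one.\<close>
  have density_ratio: "normal_density 0 \<sigma> t * (L t y * normal_density (s t) \<tau> y)
      = normal_density 0 \<rho> y * normal_density (h y) \<delta> t" for t y
  proof -
    have e: "exp (- t\<^sup>2 / (2 * \<sigma>\<^sup>2)) * (L t y * exp (- (y - s t)\<^sup>2 / (2 * \<tau>\<^sup>2)))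
        = exp (- y\<^sup>2 / (2 * \<rho>\<^sup>2)) * exp (- (t - h y)\<^sup>2 / (2 * \<delta>\<^sup>2))"
      unfolding L_def exp_add[symmetric] by (simp add: algebra_simps)
    have "normal_density 0 \<sigma> t * (L t y * normal_density (s t) \<tau> y) =
        exp (- t\<^sup>2 / (2 * \<sigma>\<^sup>2)) * (L t y * exp (- (y - s t)\<^sup>2 / (2 * \<tau>\<^sup>2)))
          / (sqrt (2 * pi * \<sigma>\<^sup>2) * sqrt (2 * pi * \<tau>\<^sup>2))"
      by (simp add: normal_density_def)
    also have "\<dots> = normal_density 0 \<rho> y * normal_density (h y) \<delta> t"
      unfolding e norm[symmetric] by (simp add: normal_density_def)
    finally show ?thesis .
  qed
  have L_nonneg: "0 \<le> L t y" for t y by (simp add: L_def)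
  have "(\<integral>\<^sup>+\<omega>. ennreal (L (X \<omega>) (s (X \<omega>) + Z \<omega>)) \<partial>M) =
     (\<integral>\<^sup>+\<omega>. \<integral>\<^sup>+y. ennreal (L (X \<omega>) y) * ennreal (normal_density (s (X \<omega>)) \<tau> y) \<partial>lborel \<partial>M)"
    by (rule nn_integral_gaussian_channel[OF indep Z s, where F = "\<lambda>t y. ennreal (L t y)"]) simp
  also have "\<dots> = (\<integral>\<^sup>+t. ennreal (normal_density 0 \<sigma> t) *
      (\<integral>\<^sup>+y. ennreal (L t y) * ennreal (normal_density (s t) \<tau> y) \<partial>lborel) \<partial>lborel)"
    by (rule distributed_nn_integral[OF X, symmetric]) (simp add: normal_density_def)
  also have "\<dots> = (\<integral>\<^sup>+t. \<integral>\<^sup>+y. ennreal (normal_density 0 \<rho> y * normal_density (h y) \<delta> t) \<partial>lborel \<partial>lborel)"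
    by (intro nn_integral_cong, subst nn_integral_cmult[symmetric])
      (simp_all add: normal_density_def[of "s _"] flip: density_ratio ennreal_mult' add: L_nonneg ennreal_mult'')
  also have "\<dots> = (\<integral>\<^sup>+y. \<integral>\<^sup>+t. ennreal (normal_density 0 \<rho> y * normal_density (h y) \<delta> t) \<partial>lborel \<partial>lborel)"
    by (rule lborel_pair.Fubini'[symmetric]) (simp add: normal_density_def)
  also have "\<dots> = (\<integral>\<^sup>+y. ennreal (normal_density 0 \<rho> y) \<partial>lborel)"
    using \<delta> by (simp add: ennreal_mult' nn_integral_cmult nn_integral_eq_integral)
  also have "\<dots> = 1"
    using \<rho> by (simp add: nn_integral_eq_integral)
  finally show ?thesis
    by (simp add: L_def)
qed

text \<open>
  The converse of rate distortion theory, without information measures. The usual argument bounds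
  the mutual information from below by the rate distortion function and from above by the
  capacity; put together, the two bounds say that the divergence of \<open>p\<close> from \<open>q\<close> is nonnegative,
  with the densities of the preceding lemma. Since \<open>ln (q / p)\<close> is a quadratic form in
  square integrable variables, this is \<open>1 + l \<le> exp l\<close> under the expectation. The output variance
  of \<open>q\<close> is left as a parameter \<open>V\<close>: a value above the true output power turns the slack into an
  additional term on the left, which later detects equality.
\<close>

lemma (in prob_space) gaussian_channel_distortion_bound:
  fixes X Z :: "'a \<Rightarrow> real"
  assumes \<sigma>: "0 < \<sigma>" and X: "distributed M lborel X (normal_density 0 \<sigma>)"
    and \<tau>: "0 < \<tau>" and Z: "distributed M lborel Z (normal_density 0 \<tau>)"
    and indep: "indep_var borel X borel Z"
    and s[measurable]: "s \<in> borel_measurable borel"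
    and s_sq: "integrable M (\<lambda>\<omega>. (s (X \<omega>))\<^sup>2)"
    and h[measurable]: "h \<in> borel_measurable borel"
    and err_sq: "integrable M (\<lambda>\<omega>. (X \<omega> - h (s (X \<omega>) + Z \<omega>))\<^sup>2)"
    and V: "0 < V"
  shows "\<sigma>\<^sup>2 * \<tau>\<^sup>2 / V * (2 - ((\<integral>\<omega>. (s (X \<omega>))\<^sup>2 \<partial>M) + \<tau>\<^sup>2) / V)
    \<le> (\<integral>\<omega>. (X \<omega> - h (s (X \<omega>) + Z \<omega>))\<^sup>2 \<partial>M)"
proof -
  let ?B = "\<sigma>\<^sup>2 * \<tau>\<^sup>2 / V" and ?S = "\<integral>\<omega>. (s (X \<omega>))\<^sup>2 \<partial>M"
    and ?D = "\<integral>\<omega>. (X \<omega> - h (s (X \<omega>) + Z \<omega>))\<^sup>2 \<partial>M"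
  have Xm[measurable]: "X \<in> borel_measurable M" and Zm[measurable]: "Z \<in> borel_measurable M"
    using indep by (auto dest: indep_var_rv1 indep_var_rv2)
  note X2 = centered_normal_integrable_square[OF \<sigma> X] centered_normal_second_moment[OF \<sigma> X]
  note Z2 = centered_normal_integrable_square[OF \<tau> Z] centered_normal_second_moment[OF \<tau> Z]
  \<comment> \<open>With these parameters the normalizing constants cancel, and \<open>\<delta>\<^sup>2\<close> is the factor in front of the bound.\<close>
  define \<rho> \<delta> where "\<rho> = sqrt V" and "\<delta> = \<sigma> * \<tau> / sqrt V"
  have \<rho>: "0 < \<rho>" "\<rho>\<^sup>2 = V" and \<delta>: "0 < \<delta>" "\<delta>\<^sup>2 = ?B" and D0: "0 < ?B"
    using V \<sigma> \<tau> by (simp_all add: \<rho>_def \<delta>_def power_divide power_mult_distrib)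
  have sZ: "integrable M (\<lambda>\<omega>. s (X \<omega>) * Z \<omega>)"
    by (rule integrable_mult_of_squares) (use s_sq Z2 in auto)
  have "indep_var borel (s \<circ> X) borel (id \<circ> Z)"
    by (rule indep_var_compose[OF indep]) auto
  then have "indep_var borel (\<lambda>\<omega>. s (X \<omega>)) borel Z"
    by (simp add: comp_def)
  then have "(\<integral>\<omega>. s (X \<omega>) * Z \<omega> \<partial>M) = (\<integral>\<omega>. s (X \<omega>) \<partial>M) * (\<integral>\<omega>. Z \<omega> \<partial>M)"
    by (rule indep_var_lebesgue_integral)
       (auto intro: square_integrable_imp_integrable s_sq centered_normal_integrable[OF \<tau> Z])
  then have cross: "(\<integral>\<omega>. s (X \<omega>) * Z \<omega> \<partial>M) = 0"
    by (simp add: normal_distributed_expectation[OF \<tau> Z])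
  have out: "integrable M (\<lambda>\<omega>. (s (X \<omega>) + Z \<omega>)\<^sup>2)" "(\<integral>\<omega>. (s (X \<omega>) + Z \<omega>)\<^sup>2 \<partial>M) = ?S + \<tau>\<^sup>2"
    using s_sq Z2 sZ cross by (simp_all add: power2_sum mult.assoc)
  define l where "l \<omega> = (X \<omega>)\<^sup>2 / (2 * \<sigma>\<^sup>2) + (Z \<omega>)\<^sup>2 / (2 * \<tau>\<^sup>2)
            - (X \<omega> - h (s (X \<omega>) + Z \<omega>))\<^sup>2 / (2 * \<delta>\<^sup>2)
            - (s (X \<omega>) + Z \<omega>)\<^sup>2 / (2 * \<rho>\<^sup>2)" for \<omega>
  have l_int: "integrable M l"
    unfolding l_def by (intro Bochner_Integration.integrable_add Bochner_Integration.integrable_diff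
      integrable_divide X2 Z2 out err_sq)
  have l_mean: "(\<integral>\<omega>. l \<omega> \<partial>M) = 1 - ?D / (2 * \<delta>\<^sup>2) - (?S + \<tau>\<^sup>2) / (2 * \<rho>\<^sup>2)"
    unfolding l_def using X2 Z2 out err_sq \<sigma> \<tau> by simp
  have el: "(\<integral>\<^sup>+\<omega>. ennreal (exp (l \<omega>)) \<partial>M) = 1"
    unfolding l_def using \<rho> \<delta> V
    by (intro gaussian_channel_relative_density[OF \<sigma> X \<tau> Z indep s h])
       (auto simp: \<rho>_def \<delta>_def)
  have [measurable]: "l \<in> borel_measurable M"
    using l_int by auto
  have el_int: "integrable M (\<lambda>\<omega>. exp (l \<omega>))"
    by (rule integrableI_nn_integral_finite[where x = 1]) (use el in auto)
  have el_mean: "(\<integral>\<omega>. exp (l \<omega>) \<partial>M) = 1"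
    using el by (simp add: integral_eq_nn_integral)
  have "(\<integral>\<omega>. 1 + l \<omega> \<partial>M) \<le> (\<integral>\<omega>. exp (l \<omega>) \<partial>M)"
    using l_int el_int by (intro integral_mono) (auto simp: exp_ge_add_one_self)
  then have "1 - ?D / (2 * \<delta>\<^sup>2) - (?S + \<tau>\<^sup>2) / (2 * \<rho>\<^sup>2) \<le> 0"
    using l_int l_mean el_mean prob_space by simp
  then have "2 - (?S + \<tau>\<^sup>2) / V \<le> ?D / ?B"
    unfolding \<rho> \<delta> mult.commute[of 2] divide_divide_eq_left[symmetric] by simp
  then show ?thesis
    unfolding pos_le_divide_eq[OF D0] by (simp only: mult.commute)
qed

section \<open>The Bayes estimator\<close>

text \<open>
  The posterior mean of \<open>X\<close> given the value \<open>y\<close> of \<open>s X\<close> plus independent \<open>N(0, \<tau>\<^sup>2)\<close> noise. An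
  explicit formula, rather than a conditional expectation known up to null sets, is used because
  the existence of a best response depends on its continuity in all parameters.
\<close>

definition (in prob_space) bayes_estimator ::
    "('a \<Rightarrow> real) \<Rightarrow> (real \<Rightarrow> real) \<Rightarrow> real \<Rightarrow> real \<Rightarrow> real" where
  "bayes_estimator X s \<tau> y =
     (\<integral>\<omega>. X \<omega> * normal_density (s (X \<omega>)) \<tau> y \<partial>M) / (\<integral>\<omega>. normal_density (s (X \<omega>)) \<tau> y \<partial>M)"

lemma normal_density_le:
  assumes "0 < c" "c \<le> \<tau>"
  shows "normal_density \<mu> \<tau> y \<le> 1 / sqrt (2 * pi * c\<^sup>2)"
proof -
  have "sqrt (2 * pi * c\<^sup>2) \<le> sqrt (2 * pi * \<tau>\<^sup>2)" "0 < sqrt (2 * pi * c\<^sup>2)"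
    using assms by (auto intro!: power_mono)
  then have "1 / sqrt (2 * pi * \<tau>\<^sup>2) \<le> 1 / sqrt (2 * pi * c\<^sup>2)"
    by (intro divide_left_mono mult_pos_pos) (use assms in auto)
  moreover have "normal_density \<mu> \<tau> y \<le> 1 / sqrt (2 * pi * \<tau>\<^sup>2)"
    unfolding normal_density_def by (intro mult_left_le) auto
  ultimately show ?thesis by linarith
qed

lemma abs_mult_normal_density_le:
  assumes "0 < c" "c \<le> \<tau>"
  shows "\<bar>a * normal_density \<mu> \<tau> y\<bar> \<le> \<bar>a\<bar> * (1 / sqrt (2 * pi * c\<^sup>2))"
  unfolding abs_mult using normal_density_le[OF assms, of \<mu> y]
  by (intro mult_left_mono) (simp_all only: abs_ge_zero abs_of_nonneg[OF normal_density_nonneg])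

context prob_space
begin

lemma integrable_mult_normal_density:
  fixes s :: "real \<Rightarrow> real"
  assumes \<tau>: "0 < \<tau>" and [measurable]: "s \<in> borel_measurable borel" "X \<in> borel_measurable M"
    and f: "integrable M f"
  shows "integrable M (\<lambda>\<omega>. f \<omega> * normal_density (s (X \<omega>)) \<tau> y)"
proof (rule Bochner_Integration.integrable_bound)
  show "integrable M (\<lambda>\<omega>. f \<omega> * (1 / sqrt (2 * pi * \<tau>\<^sup>2)))"
    using f by (rule integrable_mult_left)
  show "(\<lambda>\<omega>. f \<omega> * normal_density (s (X \<omega>)) \<tau> y) \<in> borel_measurable M"
    using f by (simp add: normal_density_def)
  show "AE \<omega> in M. norm (f \<omega> * normal_density (s (X \<omega>)) \<tau> y) \<le> norm (f \<omega> * (1 / sqrt (2 * pi * \<tau>\<^sup>2)))"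
    by (intro AE_I2, unfold real_norm_def,
        rule order_trans[OF abs_mult_normal_density_le[OF \<tau> order_refl]]) (simp add: abs_mult)
qed

lemma mean_normal_density_pos:
  fixes s :: "real \<Rightarrow> real"
  assumes \<tau>: "0 < \<tau>" and [measurable]: "s \<in> borel_measurable borel" "X \<in> borel_measurable M"
  shows "0 < (\<integral>\<omega>. normal_density (s (X \<omega>)) \<tau> y \<partial>M)"
proof -
  have "integrable M (\<lambda>\<omega>. 1 * normal_density (s (X \<omega>)) \<tau> y)"
    by (rule integrable_mult_normal_density) (use \<tau> in auto)
  then have "(\<integral>\<omega>. 0 \<partial>M) < (\<integral>\<omega>. normal_density (s (X \<omega>)) \<tau> y \<partial>M)"
    by (intro integral_less_AE_space) (auto simp: normal_density_pos[OF \<tau>] emeasure_space_1)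
  then show ?thesis by simp
qed

lemma borel_measurable_bayes_estimator[measurable]:
  assumes [measurable]: "s \<in> borel_measurable borel" "X \<in> borel_measurable M"
  shows "bayes_estimator X s \<tau> \<in> borel_measurable borel"
  unfolding bayes_estimator_def[abs_def] normal_density_def by measurable

text \<open>
  For each output \<open>y\<close> the contribution to the cost is a quadratic polynomial in the value of the
  estimator at \<open>y\<close>, minimal at the posterior mean. The comparison takes place among nonnegative
  integrals, so the competitor may have infinite cost.
\<close>

lemma bayes_estimator_optimal:
  assumes indep: "indep_var borel X borel Z"
    and \<tau>: "0 < \<tau>" and Z: "distributed M lborel Z (normal_density 0 \<tau>)"
    and X2: "integrable M (\<lambda>\<omega>. (X \<omega>)\<^sup>2)"
    and s[measurable]: "s \<in> borel_measurable borel"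
    and d[measurable]: "d \<in> borel_measurable borel"
  shows "(\<integral>\<^sup>+\<omega>. ennreal ((X \<omega> - bayes_estimator X s \<tau> (s (X \<omega>) + Z \<omega>))\<^sup>2) \<partial>M)
    \<le> (\<integral>\<^sup>+\<omega>. ennreal ((X \<omega> - d (s (X \<omega>) + Z \<omega>))\<^sup>2) \<partial>M)"
proof -
  have [measurable]: "X \<in> borel_measurable M"
    using indep by (auto dest: indep_var_rv1)
  have X1: "integrable M X"
    by (rule square_integrable_imp_integrable) (use X2 in auto)
  define k where "k y \<omega> = normal_density (s (X \<omega>)) \<tau> y" for y \<omega>
  have k_nonneg: "0 \<le> k y \<omega>" for y \<omega> by (simp add: k_def)
  have [measurable]: "(\<lambda>(\<omega>, y). k y \<omega>) \<in> borel_measurable (M \<Otimes>\<^sub>M borel)"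
    unfolding k_def normal_density_def by measurable
  interpret P: pair_sigma_finite M lborel ..
  have cost: "(\<integral>\<^sup>+\<omega>. ennreal ((X \<omega> - e (s (X \<omega>) + Z \<omega>))\<^sup>2) \<partial>M) =
      (\<integral>\<^sup>+y. \<integral>\<^sup>+\<omega>. ennreal ((X \<omega> - e y)\<^sup>2 * k y \<omega>) \<partial>M \<partial>lborel)"
    if [measurable]: "e \<in> borel_measurable borel" for e
  proof -
    have "(\<integral>\<^sup>+\<omega>. ennreal ((X \<omega> - e (s (X \<omega>) + Z \<omega>))\<^sup>2) \<partial>M) =
       (\<integral>\<^sup>+\<omega>. \<integral>\<^sup>+y. ennreal ((X \<omega> - e y)\<^sup>2 * k y \<omega>) \<partial>lborel \<partial>M)"
      by (subst nn_integral_gaussian_channel[OF indep Z s, where F = "\<lambda>t y. ennreal ((t - e y)\<^sup>2)"])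
         (simp_all add: k_def ennreal_mult)
    also have "\<dots> = (\<integral>\<^sup>+y. \<integral>\<^sup>+\<omega>. ennreal ((X \<omega> - e y)\<^sup>2 * k y \<omega>) \<partial>M \<partial>lborel)"
      by (rule P.Fubini'[symmetric]) simp
    finally show ?thesis .
  qed
  have "(\<integral>\<^sup>+\<omega>. ennreal ((X \<omega> - bayes_estimator X s \<tau> y)\<^sup>2 * k y \<omega>) \<partial>M)
     \<le> (\<integral>\<^sup>+\<omega>. ennreal ((X \<omega> - d y)\<^sup>2 * k y \<omega>) \<partial>M)" for y
  proof -
    let ?q = "\<integral>\<omega>. k y \<omega> \<partial>M" and ?l = "\<integral>\<omega>. X \<omega> * k y \<omega> \<partial>M" and ?m = "\<integral>\<omega>. (X \<omega>)\<^sup>2 * k y \<omega> \<partial>M"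
    have q: "0 < ?q"
      unfolding k_def by (rule mean_normal_density_pos[OF \<tau>]) simp_all
    have ints: "integrable M (\<lambda>\<omega>. 1 * k y \<omega>)" "integrable M (\<lambda>\<omega>. X \<omega> * k y \<omega>)"
        "integrable M (\<lambda>\<omega>. (X \<omega>)\<^sup>2 * k y \<omega>)"
      unfolding k_def by (intro integrable_mult_normal_density \<tau>; simp add: X1 X2)+
    have expand: "(\<lambda>\<omega>. (X \<omega> - c)\<^sup>2 * k y \<omega>) =
        (\<lambda>\<omega>. (X \<omega>)\<^sup>2 * k y \<omega> - 2 * c * (X \<omega> * k y \<omega>) + c\<^sup>2 * (1 * k y \<omega>))" for c
      by (auto simp: power2_diff algebra_simps)
    have int: "integrable M (\<lambda>\<omega>. (X \<omega> - c)\<^sup>2 * k y \<omega>)" for c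
      unfolding expand using ints by simp
    have val: "(\<integral>\<omega>. (X \<omega> - c)\<^sup>2 * k y \<omega> \<partial>M) = ?m - 2 * c * ?l + c\<^sup>2 * ?q" for c
      unfolding expand using ints by simp
    have "(?m - 2 * d y * ?l + (d y)\<^sup>2 * ?q) - (?m - 2 * (?l / ?q) * ?l + (?l / ?q)\<^sup>2 * ?q)
        = ?q * (d y - ?l / ?q)\<^sup>2"
      using q by (simp add: power2_eq_square field_simps)
    moreover have "0 \<le> ?q * (d y - ?l / ?q)\<^sup>2"
      using q by simp
    moreover have "bayes_estimator X s \<tau> y = ?l / ?q"
      by (simp add: bayes_estimator_def k_def)
    ultimately have "(\<integral>\<omega>. (X \<omega> - bayes_estimator X s \<tau> y)\<^sup>2 * k y \<omega> \<partial>M) \<le> (\<integral>\<omega>. (X \<omega> - d y)\<^sup>2 * k y \<omega> \<partial>M)"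
      unfolding val by simp
    then show ?thesis
      by (simp add: nn_integral_eq_integral int k_nonneg ennreal_leI)
  qed
  then show ?thesis
    by (subst (1 2) cost) (auto intro: nn_integral_mono)
qed

text \<open>
  The Gaussian kernel is bounded as long as the noise level stays away from \<open>0\<close>, so numerator and
  denominator converge by dominated convergence.
\<close>

lemma tendsto_bayes_estimator:
  fixes S :: "nat \<Rightarrow> real \<Rightarrow> real"
  assumes X1: "integrable M X"
    and S[measurable]: "\<And>n. S n \<in> borel_measurable borel" and s[measurable]: "s \<in> borel_measurable borel"
    and S_lim: "\<And>t. (\<lambda>n. S n t) \<longlonglongrightarrow> s t"
    and c: "0 < c" "\<And>n. c \<le> T n" and T_lim: "T \<longlonglongrightarrow> \<tau>"
    and Y_lim: "Y \<longlonglongrightarrow> y"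
  shows "(\<lambda>n. bayes_estimator X (S n) (T n) (Y n)) \<longlonglongrightarrow> bayes_estimator X s \<tau> y"
proof -
  have [measurable]: "X \<in> borel_measurable M" using X1 by auto
  have \<tau>: "c \<le> \<tau>"
    using T_lim c by (intro LIMSEQ_le_const) auto
  have kernel_lim: "(\<lambda>n. normal_density (S n t) (T n) (Y n)) \<longlonglongrightarrow> normal_density (s t) \<tau> y" for t
    unfolding normal_density_def using \<tau> c
    by (intro tendsto_intros S_lim T_lim Y_lim) auto
  have lim: "(\<lambda>n. \<integral>\<omega>. f \<omega> * normal_density (S n (X \<omega>)) (T n) (Y n) \<partial>M)
      \<longlonglongrightarrow> (\<integral>\<omega>. f \<omega> * normal_density (s (X \<omega>)) \<tau> y \<partial>M)" if f: "integrable M f" for f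
  proof (rule integral_dominated_convergence)
    have [measurable]: "f \<in> borel_measurable M" using f by auto
    show "(\<lambda>\<omega>. f \<omega> * normal_density (s (X \<omega>)) \<tau> y) \<in> borel_measurable M"
      "(\<lambda>\<omega>. f \<omega> * normal_density (S n (X \<omega>)) (T n) (Y n)) \<in> borel_measurable M" for n
      by (simp_all add: normal_density_def)
    show "integrable M (\<lambda>\<omega>. \<bar>f \<omega>\<bar> * (1 / sqrt (2 * pi * c\<^sup>2)))"
      using f by (intro integrable_mult_left integrable_abs)
    show "AE \<omega> in M. (\<lambda>n. f \<omega> * normal_density (S n (X \<omega>)) (T n) (Y n))
        \<longlonglongrightarrow> f \<omega> * normal_density (s (X \<omega>)) \<tau> y"
      by (intro AE_I2 tendsto_intros kernel_lim)
    show "AE \<omega> in M. norm (f \<omega> * normal_density (S n (X \<omega>)) (T n) (Y n))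
        \<le> \<bar>f \<omega>\<bar> * (1 / sqrt (2 * pi * c\<^sup>2))" for n
      unfolding real_norm_def by (intro AE_I2 abs_mult_normal_density_le c)
  qed
  have "0 < (\<integral>\<omega>. normal_density (s (X \<omega>)) \<tau> y \<partial>M)"
    by (rule mean_normal_density_pos) (use \<tau> c in auto)
  then show ?thesis
    unfolding bayes_estimator_def using lim[of "\<lambda>_. 1"] lim[OF X1]
    by (intro tendsto_divide) auto
qed

end

section \<open>The game\<close>

locale combining_game = prob_space M for M :: "'a measure" +
  fixes x v w :: "'a \<Rightarrow> real" and \<sigma>x \<sigma>v \<sigma>w :: real
  assumes pos: "0 < \<sigma>x" "0 < \<sigma>v" "0 < \<sigma>w"
    and x: "distributed M lborel x (normal_density 0 \<sigma>x)"
    and v: "distributed M lborel v (normal_density 0 \<sigma>v)"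
    and w: "distributed M lborel w (normal_density 0 \<sigma>w)"
    and indep: "indep_vars (\<lambda>_. borel) (\<lambda>i. [x, v, w] ! i) {..<3}"
begin

text \<open>
  The received signal is the output of one Gaussian channel with source \<open>x\<close>: the combination
  parameter determines both the function of \<open>x\<close> that is sent, \<open>mix\<close>, and the noise that is added.
\<close>

definition noise :: "real \<Rightarrow> 'a \<Rightarrow> real" where
  "noise \<alpha> \<omega> = \<alpha> * v \<omega> + (1 - \<alpha>) * w \<omega>"

definition noise_sd :: "real \<Rightarrow> real" where
  "noise_sd \<alpha> = sqrt ((\<alpha> * \<sigma>v)\<^sup>2 + ((1 - \<alpha>) * \<sigma>w)\<^sup>2)"

definition mix :: "encoder \<Rightarrow> real \<Rightarrow> real \<Rightarrow> real" where
  "mix g \<alpha> t = \<alpha> * g t + (1 - \<alpha>) * t"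

abbreviation err :: "encoder \<Rightarrow> decoder \<Rightarrow> 'a \<Rightarrow> real" where
  "err g d \<omega> \<equiv> x \<omega> - estimate x v w g d \<omega>"

abbreviation power_of :: "encoder \<Rightarrow> real" where
  "power_of g \<equiv> (\<integral>\<omega>. (g (x \<omega>))\<^sup>2 \<partial>M)"

lemma measurable_signals[measurable]:
  "x \<in> borel_measurable M" "v \<in> borel_measurable M" "w \<in> borel_measurable M"
  using x v w by (simp_all add: distributed_def)

lemma measurable_noise[measurable]: "noise \<alpha> \<in> borel_measurable M"
  unfolding noise_def[abs_def] by measurable

lemma measurable_mix[measurable]:
  assumes [measurable]: "g \<in> borel_measurable borel"
  shows "mix g \<alpha> \<in> borel_measurable borel"
  unfolding mix_def[abs_def] by measurable

lemma received_eq: "received x v w g \<alpha> \<omega> = mix g \<alpha> (x \<omega>) + noise \<alpha> \<omega>"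
  by (simp add: received_def mix_def noise_def algebra_simps)

lemma measurable_received[measurable]:
  assumes [measurable]: "g \<in> borel_measurable borel"
  shows "received x v w g \<alpha> \<in> borel_measurable M"
  unfolding received_eq[abs_def] by measurable

lemma measurable_err[measurable]:
  assumes [measurable]: "g \<in> borel_measurable borel" "snd d \<in> borel_measurable borel"
  shows "err g d \<in> borel_measurable M"
  unfolding estimate_def[abs_def] by measurable

lemma x_moments: "integrable M x" "integrable M (\<lambda>\<omega>. (x \<omega>)\<^sup>2)" "(\<integral>\<omega>. (x \<omega>)\<^sup>2 \<partial>M) = \<sigma>x\<^sup>2"
  using centered_normal_integrable[OF pos(1) x] centered_normal_integrable_square[OF pos(1) x]
    centered_normal_second_moment[OF pos(1) x] by auto

lemma noise_sd_square: "(noise_sd \<alpha>)\<^sup>2 = \<alpha>\<^sup>2 * \<sigma>v\<^sup>2 + (1 - \<alpha>)\<^sup>2 * \<sigma>w\<^sup>2"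
  by (simp add: noise_sd_def power_mult_distrib)

lemma noise_sd_pos: "0 < noise_sd \<alpha>"
proof -
  have "\<alpha> \<noteq> 0 \<or> 1 - \<alpha> \<noteq> 0" by auto
  then show ?thesis
    unfolding noise_sd_def using pos by (auto simp: sum_power2_gt_zero_iff)
qed

text \<open>
  The two end points are separate because there one of the scaled noises is the constant \<open>0\<close>, which
  has no density.
\<close>

lemma noise_normal: "distributed M lborel (noise \<alpha>) (normal_density 0 (noise_sd \<alpha>))"
proof -
  have scale: "distributed M lborel (\<lambda>\<omega>. c * f \<omega>) (normal_density 0 (\<bar>c\<bar> * \<sigma>))"
    if "distributed M lborel f (normal_density 0 \<sigma>)" "0 < \<sigma>" "c \<noteq> 0" for f \<sigma> c
    using normal_density_affine[OF that, of 0] by simp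
  consider "\<alpha> = 0" | "\<alpha> = 1" | "\<alpha> \<noteq> 0" "1 - \<alpha> \<noteq> 0" by fastforce
  then show ?thesis
  proof cases
    case 1
    then show ?thesis using w pos by (simp add: noise_def[abs_def] noise_sd_def)
  next
    case 2
    then show ?thesis using v pos by (simp add: noise_def[abs_def] noise_sd_def)
  next
    case 3
    have "indep_vars (\<lambda>_. borel) (\<lambda>i \<omega>. (if i = 1 then \<alpha> else 1 - \<alpha>) * ([x, v, w] ! i) \<omega>) {..<3}"
      by (rule indep_vars_compose2[OF indep]) simp
    then have "indep_vars (\<lambda>_. borel) (\<lambda>i \<omega>. (if i = 1 then \<alpha> else 1 - \<alpha>) * ([x, v, w] ! i) \<omega>) (insert 1 {2})"
      by (rule indep_vars_subset) auto
    from indep_vars_sum[OF _ _ this]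
    have "indep_var borel (\<lambda>\<omega>. \<alpha> * v \<omega>) borel (\<lambda>\<omega>. (1 - \<alpha>) * w \<omega>)" by simp
    from add_indep_normal[OF this _ _ scale[OF v] scale[OF w]] 3 pos
    show ?thesis
      by (simp add: noise_def[abs_def] noise_sd_def power_mult_distrib)
  qed
qed

lemma indep_noise: "indep_var borel x borel (noise \<alpha>)"
proof -
  let ?c = "\<lambda>i. if i = (0::nat) then 1 else if i = 1 then \<alpha> else 1 - \<alpha>"
  have "indep_vars (\<lambda>_. borel) (\<lambda>i \<omega>. ?c i * ([x, v, w] ! i) \<omega>) {..<3}"
    by (rule indep_vars_compose2[OF indep]) simp
  moreover have "{..<3::nat} = insert 0 {1, 2}" by auto
  ultimately have "indep_vars (\<lambda>_. borel) (\<lambda>i \<omega>. ?c i * ([x, v, w] ! i) \<omega>) (insert 0 {1, 2})"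
    by metis
  then have "indep_var borel (\<lambda>\<omega>. ?c 0 * ([x, v, w] ! 0) \<omega>) borel (\<lambda>\<omega>. \<Sum>i\<in>{1, 2}. ?c i * ([x, v, w] ! i) \<omega>)"
    by (rule indep_vars_sum[rotated 2]) auto
  then show ?thesis
    by (simp add: noise_def[abs_def])
qed

lemma encoder_strategyD:
  assumes "encoder_strategy M x g"
  shows "g \<in> borel_measurable borel" "integrable M (\<lambda>\<omega>. (g (x \<omega>))\<^sup>2)"
  using assms by (auto simp: encoder_strategy_def)

lemma linear_encoder: "encoder_strategy M x (\<lambda>t. A * t)"
  using x_moments by (auto simp: encoder_strategy_def power_mult_distrib)

lemma power_linear: "power_of (\<lambda>t. A * t) = A\<^sup>2 * \<sigma>x\<^sup>2"
  using x_moments by (simp add: power_mult_distrib)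

section \<open>Existence of best responses\<close>

text \<open>
  Received signal and estimate converge pointwise as the combining parameter does, so the claim is
  Fatou's lemma.
\<close>

lemma bayes_cost_lower_semicontinuous:
  assumes g: "encoder_strategy M x g"
    and a: "a \<longlonglongrightarrow> \<alpha>" "\<And>n. a n \<in> {0..1}" "\<alpha> \<in> {0..1}"
  defines "B \<equiv> \<lambda>\<alpha>. (\<alpha>, bayes_estimator x (mix g \<alpha>) (noise_sd \<alpha>))"
  shows "decoder_cost M x v w g (B \<alpha>) \<le> liminf (\<lambda>n. decoder_cost M x v w g (B (a n)))"
proof -
  note [measurable] = encoder_strategyD(1)[OF g]
  \<comment> \<open>The noise level is bounded away from \<open>0\<close>, uniformly in the combining parameter.\<close>
  obtain c where c: "0 < c" "\<And>\<alpha>. \<alpha> \<in> {0..1} \<Longrightarrow> c \<le> noise_sd \<alpha>"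
  proof -
    have "continuous_on {0..1} noise_sd"
      unfolding noise_sd_def by (intro continuous_intros)
    then obtain m where "m \<in> {0..1}" "\<And>\<alpha>. \<alpha> \<in> {0..1} \<Longrightarrow> noise_sd m \<le> noise_sd \<alpha>"
      using continuous_attains_inf[of "{0..1::real}" noise_sd] by auto
    with noise_sd_pos[of m] that show ?thesis by blast
  qed
  have r_lim: "(\<lambda>n. received x v w g (a n) \<omega>) \<longlonglongrightarrow> received x v w g \<alpha> \<omega>" for \<omega>
    unfolding received_def by (intro tendsto_intros a)
  have sd_lim: "(\<lambda>n. noise_sd (a n)) \<longlonglongrightarrow> noise_sd \<alpha>"
    unfolding noise_sd_def by (intro tendsto_intros a)
  have est_lim: "(\<lambda>n. estimate x v w g (B (a n)) \<omega>) \<longlonglongrightarrow> estimate x v w g (B \<alpha>) \<omega>" for \<omega>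
    unfolding estimate_def B_def fst_conv snd_conv
  proof (rule tendsto_bayes_estimator[where c = c])
    show "(\<lambda>n. mix g (a n) t) \<longlonglongrightarrow> mix g \<alpha> t" for t
      unfolding mix_def by (intro tendsto_intros a)
  qed (use x_moments c a r_lim sd_lim in auto)
  have "ennreal ((err g (B \<alpha>) \<omega>)\<^sup>2) = liminf (\<lambda>n. ennreal ((err g (B (a n)) \<omega>)\<^sup>2))" for \<omega>
    by (rule lim_imp_Liminf[symmetric]) (auto intro!: tendsto_intros est_lim)
  then have "decoder_cost M x v w g (B \<alpha>) = (\<integral>\<^sup>+\<omega>. liminf (\<lambda>n. ennreal ((err g (B (a n)) \<omega>)\<^sup>2)) \<partial>M)"
    by (simp add: decoder_cost_def)
  also have "\<dots> \<le> liminf (\<lambda>n. decoder_cost M x v w g (B (a n)))"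
    unfolding decoder_cost_def
    by (rule nn_integral_liminf) (use measurable_err[of g "B _"] in \<open>simp add: B_def\<close>)
  finally show ?thesis .
qed

text \<open>
  For a fixed combining parameter the Bayes estimator is optimal; the resulting cost is lower
  semicontinuous in the parameter and so attains its infimum over the compact interval.
\<close>

lemma best_response_exists:
  assumes g: "encoder_strategy M x g"
  shows "\<exists>d. best_response M x v w g d"
proof -
  note [measurable] = encoder_strategyD(1)[OF g]
  define B where "B \<alpha> = (\<alpha>, bayes_estimator x (mix g \<alpha>) (noise_sd \<alpha>))" for \<alpha>
  define c where "c \<alpha> = decoder_cost M x v w g (B \<alpha>)" for \<alpha>
  obtain u where u: "\<And>n. u n \<in> c ` {0..1}" "u \<longlonglongrightarrow> Inf (c ` {0..1})"
    using Inf_as_limit[of "c ` {0..1}"] by auto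
  then have "\<forall>n. \<exists>\<alpha>. \<alpha> \<in> {0..1} \<and> u n = c \<alpha>" by blast
  then obtain a where a: "\<And>n. a n \<in> {0..1}" "\<And>n. u n = c (a n)" by metis
  have "seq_compact {0..1::real}"
    by (simp add: compact_imp_seq_compact)
  then obtain \<alpha> r where \<alpha>: "\<alpha> \<in> {0..1}" "strict_mono r" "(a \<circ> r) \<longlonglongrightarrow> \<alpha>"
    using a(1) unfolding seq_compact_def by blast
  have "(\<lambda>n. c (a (r n))) \<longlonglongrightarrow> Inf (c ` {0..1})"
    using LIMSEQ_subseq_LIMSEQ[OF u(2) \<alpha>(2)] by (simp add: comp_def a(2))
  then have "liminf (\<lambda>n. c (a (r n))) = Inf (c ` {0..1})"
    by (rule lim_imp_Liminf[rotated]) simp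
  moreover have "c \<alpha> \<le> liminf (\<lambda>n. c (a (r n)))"
    unfolding c_def B_def
    by (rule bayes_cost_lower_semicontinuous[OF g]) (use \<alpha> a in \<open>auto simp: comp_def\<close>)
  ultimately have min: "c \<alpha> \<le> c \<beta>" if "\<beta> \<in> {0..1}" for \<beta>
    using INF_lower[OF that, of c] by simp
  have "best_response M x v w g (B \<alpha>)"
    unfolding best_response_def
  proof (intro conjI allI impI)
    show "decoder_strategy (B \<alpha>)"
      using \<alpha> by (simp add: decoder_strategy_def B_def)
    fix d assume d: "decoder_strategy d"
    have "decoder_cost M x v w g (B \<alpha>) \<le> decoder_cost M x v w g (B (fst d))"
      using min[of "fst d"] d by (simp add: c_def decoder_strategy_def)
    also have "\<dots> \<le> decoder_cost M x v w g d"
      unfolding decoder_cost_def estimate_def received_eq B_def fst_conv snd_conv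
      by (rule bayes_estimator_optimal[OF indep_noise noise_sd_pos noise_normal])
         (use x_moments d in \<open>auto simp: decoder_strategy_def\<close>)
    finally show "decoder_cost M x v w g (B \<alpha>) \<le> decoder_cost M x v w g d" .
  qed
  then show ?thesis ..
qed

section \<open>The distortion bound of the game\<close>

text \<open>
  For a linear \<open>g\<close> this is \<open>\<sigma>x\<^sup>2\<close> times the posterior precision of \<open>x\<close> given both \<open>g x + v\<close> and \<open>x + w\<close>,
  so \<open>\<sigma>x\<^sup>2 / snr_sum g\<close> is the error of a decoder that observes the two separately.
\<close>

definition snr_sum :: "encoder \<Rightarrow> real" where
  "snr_sum g = 1 + power_of g / \<sigma>v\<^sup>2 + \<sigma>x\<^sup>2 / \<sigma>w\<^sup>2"

lemma snr_sum_pos: "0 < snr_sum g"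
  unfolding snr_sum_def by (intro add_pos_nonneg) auto

text \<open>
  Put \<open>a = \<alpha> \<sigma>v\<close>, \<open>c = (1 - \<alpha>) \<sigma>w\<close>, \<open>U = g x / \<sigma>v\<close> and \<open>W = x / \<sigma>w\<close>. Lagrange's identity
  \<open>(a U + c W)\<^sup>2 + (c U - a W)\<^sup>2 = (a\<^sup>2 + c\<^sup>2) (U\<^sup>2 + W\<^sup>2)\<close> says that the power of the mixed signal
  falls short of \<open>(noise_sd \<alpha>)\<^sup>2 * (snr_sum g - 1)\<close> by the mean of \<open>(c U - a W)\<^sup>2\<close>, where
  \<open>c U - a W\<close> is \<open>mismatch\<close> divided by \<open>\<sigma>v * \<sigma>w\<close>. Keeping this term, instead of merely using the
  Cauchy-Schwarz inequality, gives the characterization of equality for free.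
\<close>

lemma distortion_bound:
  assumes g: "encoder_strategy M x g" and d: "decoder_strategy d"
    and err_sq: "integrable M (\<lambda>\<omega>. (err g d \<omega>)\<^sup>2)"
  defines "mismatch \<equiv> \<lambda>\<omega>. (1 - fst d) * \<sigma>w\<^sup>2 * g (x \<omega>) - fst d * \<sigma>v\<^sup>2 * x \<omega>"
  shows "integrable M (\<lambda>\<omega>. (mismatch \<omega>)\<^sup>2)"
    and "\<sigma>x\<^sup>2 / snr_sum g * (1 + (\<integral>\<omega>. (mismatch \<omega>)\<^sup>2 \<partial>M) /
        (\<sigma>v\<^sup>2 * \<sigma>w\<^sup>2 * (noise_sd (fst d))\<^sup>2 * snr_sum g)) \<le> (\<integral>\<omega>. (err g d \<omega>)\<^sup>2 \<partial>M)"
proof -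
  note [measurable] = encoder_strategyD(1)[OF g]
  note gsq = encoder_strategyD(2)[OF g]
  let ?\<alpha> = "fst d" and ?P = "power_of g" and ?C = "\<integral>\<omega>. g (x \<omega>) * x \<omega> \<partial>M"
  let ?N = "(noise_sd (fst d))\<^sup>2"
  have cross: "integrable M (\<lambda>\<omega>. g (x \<omega>) * x \<omega>)"
    by (rule integrable_mult_of_squares) (use gsq x_moments in auto)
  have quad_eq: "(\<lambda>\<omega>. (p * g (x \<omega>) + q * x \<omega>)\<^sup>2) =
      (\<lambda>\<omega>. p\<^sup>2 * (g (x \<omega>))\<^sup>2 + 2 * p * q * (g (x \<omega>) * x \<omega>) + q\<^sup>2 * (x \<omega>)\<^sup>2)" for p q
    by (auto simp: power2_sum power_mult_distrib algebra_simps)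
  have quad: "integrable M (\<lambda>\<omega>. (p * g (x \<omega>) + q * x \<omega>)\<^sup>2)"
    "(\<integral>\<omega>. (p * g (x \<omega>) + q * x \<omega>)\<^sup>2 \<partial>M) = p\<^sup>2 * ?P + 2 * p * q * ?C + q\<^sup>2 * \<sigma>x\<^sup>2" for p q
    unfolding quad_eq using gsq cross x_moments by simp_all
  have mismatch_eq: "mismatch = (\<lambda>\<omega>. ((1 - ?\<alpha>) * \<sigma>w\<^sup>2) * g (x \<omega>) + (- (?\<alpha> * \<sigma>v\<^sup>2)) * x \<omega>)"
    by (auto simp: mismatch_def)
  show "integrable M (\<lambda>\<omega>. (mismatch \<omega>)\<^sup>2)"
    unfolding mismatch_eq by (rule quad)
  let ?G = "\<integral>\<omega>. (mismatch \<omega>)\<^sup>2 \<partial>M" and ?S = "\<integral>\<omega>. (mix g ?\<alpha> (x \<omega>))\<^sup>2 \<partial>M"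
  have S: "integrable M (\<lambda>\<omega>. (mix g ?\<alpha> (x \<omega>))\<^sup>2)"
      "?S = ?\<alpha>\<^sup>2 * ?P + 2 * ?\<alpha> * (1 - ?\<alpha>) * ?C + (1 - ?\<alpha>)\<^sup>2 * \<sigma>x\<^sup>2"
    unfolding mix_def using quad by auto
  \<comment> \<open>The largest output power that the Cauchy-Schwarz inequality permits for this encoder power.\<close>
  define V where "V = ?N * snr_sum g"
  have V: "0 < V" unfolding V_def using noise_sd_pos[of ?\<alpha>] snr_sum_pos[of g] by simp
  have SV: "?S + ?N = V - ?G / (\<sigma>v\<^sup>2 * \<sigma>w\<^sup>2)"
    unfolding S mismatch_eq quad V_def noise_sd_square snr_sum_def using pos
    by (simp add: field_simps) algebra
  have "\<sigma>x\<^sup>2 * ?N / V * (2 - (?S + ?N) / V) \<le> (\<integral>\<omega>. (err g d \<omega>)\<^sup>2 \<partial>M)"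
    unfolding estimate_def received_eq
    by (rule gaussian_channel_distortion_bound[OF pos(1) x noise_sd_pos noise_normal indep_noise _ S(1) _ _ V])
       (use d err_sq in \<open>auto simp: decoder_strategy_def estimate_def received_eq\<close>)
  moreover have "\<sigma>x\<^sup>2 * ?N / V = \<sigma>x\<^sup>2 / snr_sum g"
    unfolding V_def using noise_sd_pos[of ?\<alpha>] by simp
  moreover have "2 - (?S + ?N) / V = 1 + ?G / (\<sigma>v\<^sup>2 * \<sigma>w\<^sup>2 * ?N * snr_sum g)"
    unfolding SV using V V_def pos noise_sd_pos[of ?\<alpha>] snr_sum_pos[of g] by (simp add: diff_divide_distrib mult.assoc)
  ultimately show "\<sigma>x\<^sup>2 / snr_sum g * (1 + ?G / (\<sigma>v\<^sup>2 * \<sigma>w\<^sup>2 * ?N * snr_sum g)) \<le> (\<integral>\<omega>. (err g d \<omega>)\<^sup>2 \<partial>M)"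
    by simp
qed

end

section \<open>Power against distortion\<close>

text \<open>
  In the variable \<open>u = 1 + P / \<sigma>v\<^sup>2 + \<sigma>x\<^sup>2 / \<sigma>w\<^sup>2\<close> the function \<open>f\<close> is \<open>\<sigma>x\<^sup>2 / u\<close> plus an affine term, which
  is strictly convex. The first order condition holds at the claimed minimizer with equality in
  the interior case; at the boundary \<open>P = 0\<close> the derivative is nonnegative.
\<close>

lemma power_distortion_tradeoff:
  fixes \<sigma>x \<sigma>v \<sigma>w \<theta> a P :: real
  assumes pos: "0 < \<sigma>x" "0 < \<sigma>v" "0 < \<sigma>w" "0 < \<theta>"
    and a: "a = (if \<theta> < \<sigma>x\<^sup>2 / (\<sigma>v\<^sup>2 * (\<sigma>x\<^sup>2 / \<sigma>w\<^sup>2 + 1)\<^sup>2)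
            then sqrt (\<sigma>v\<^sup>2 / (\<theta> * \<sigma>x\<^sup>2)) - \<sigma>v\<^sup>2 / \<sigma>x\<^sup>2 * (\<sigma>x\<^sup>2 / \<sigma>w\<^sup>2 + 1)
            else 0)"
  defines "f \<equiv> \<lambda>P. \<sigma>x\<^sup>2 / (1 + P / \<sigma>v\<^sup>2 + \<sigma>x\<^sup>2 / \<sigma>w\<^sup>2) + \<theta> * P"
  shows "0 \<le> a"
    and "0 \<le> P \<Longrightarrow> f (a * \<sigma>x\<^sup>2) \<le> f P"
    and "0 \<le> P \<Longrightarrow> f P \<le> f (a * \<sigma>x\<^sup>2) \<Longrightarrow> P = a * \<sigma>x\<^sup>2"
proof -
  define \<kappa> u0 where "\<kappa> = \<sigma>x\<^sup>2 / \<sigma>w\<^sup>2 + 1" and "u0 = \<kappa> + a * \<sigma>x\<^sup>2 / \<sigma>v\<^sup>2"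
  have \<kappa>: "0 < \<kappa>" unfolding \<kappa>_def by (intro add_nonneg_pos) auto
  have "0 \<le> a \<and> 0 < u0 \<and> (\<forall>u\<ge>\<kappa>. \<sigma>x\<^sup>2 / u0\<^sup>2 * (u - u0) \<le> \<theta> * \<sigma>v\<^sup>2 * (u - u0))"
  proof (cases "\<theta> < \<sigma>x\<^sup>2 / (\<sigma>v\<^sup>2 * \<kappa>\<^sup>2)")
    case True
    let ?r = "sqrt (\<sigma>v\<^sup>2 / (\<theta> * \<sigma>x\<^sup>2))"
    have a: "a = ?r - \<sigma>v\<^sup>2 / \<sigma>x\<^sup>2 * \<kappa>"
      using True a by (simp add: \<kappa>_def)
    have "(\<sigma>v\<^sup>2 / \<sigma>x\<^sup>2 * \<kappa>)\<^sup>2 \<le> \<sigma>v\<^sup>2 / (\<theta> * \<sigma>x\<^sup>2)"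
    proof -
      have "\<theta> * (\<sigma>v\<^sup>2 * \<kappa>\<^sup>2) \<le> \<sigma>x\<^sup>2"
        using True pos \<kappa> by (simp add: pos_less_divide_eq)
      from mult_left_mono[OF this, of "\<sigma>v\<^sup>2 * \<sigma>x\<^sup>2"] show ?thesis
        using pos by (simp add: divide_simps power2_eq_square mult_ac)
    qed
    then have "0 \<le> a"
      unfolding a by (simp add: real_le_rsqrt)
    have u0: "u0 = \<sigma>x\<^sup>2 / \<sigma>v\<^sup>2 * ?r"
      unfolding u0_def a using pos by (simp add: field_simps)
    have "u0\<^sup>2 = (\<sigma>x\<^sup>2 / \<sigma>v\<^sup>2)\<^sup>2 * (\<sigma>v\<^sup>2 / (\<theta> * \<sigma>x\<^sup>2))"
      unfolding u0 power_mult_distrib using pos by simp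
    also have "\<dots> = \<sigma>x\<^sup>2 / (\<theta> * \<sigma>v\<^sup>2)"
      using pos by (simp add: field_simps power2_eq_square)
    finally have "\<sigma>x\<^sup>2 / u0\<^sup>2 = \<theta> * \<sigma>v\<^sup>2"
      using pos by simp
    moreover have "0 < u0" unfolding u0 using pos by simp
    ultimately show ?thesis using \<open>0 \<le> a\<close> by simp
  next
    case False
    then have "a = 0" "u0 = \<kappa>"
      using a by (simp_all add: \<kappa>_def u0_def)
    moreover have "\<sigma>x\<^sup>2 / \<kappa>\<^sup>2 \<le> \<theta> * \<sigma>v\<^sup>2"
      using False pos \<kappa> by (simp add: field_simps)
    ultimately show ?thesis
      using \<kappa> by (auto simp del: times_divide_eq_left intro: mult_right_mono)
  qed
  then have u0: "0 < u0" and first_order: "\<And>u. \<kappa> \<le> u \<Longrightarrow> \<sigma>x\<^sup>2 / u0\<^sup>2 * (u - u0) \<le> \<theta> * \<sigma>v\<^sup>2 * (u - u0)"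
    and "0 \<le> a" by auto
  show "0 \<le> a" by fact
  have gap: "\<exists>c>0. f (a * \<sigma>x\<^sup>2) + c * (P - a * \<sigma>x\<^sup>2)\<^sup>2 \<le> f P" if P: "0 \<le> P"
  proof -
    define u where "u = \<kappa> + P / \<sigma>v\<^sup>2"
    have u: "\<kappa> \<le> u" "0 < u"
      using P \<kappa> by (auto simp: u_def intro: add_pos_nonneg)
    have diff: "\<theta> * P - \<theta> * (a * \<sigma>x\<^sup>2) = \<theta> * \<sigma>v\<^sup>2 * (u - u0)"
      using pos by (simp add: u_def u0_def field_simps)
    have fs: "f P = \<sigma>x\<^sup>2 / u + \<theta> * P" "f (a * \<sigma>x\<^sup>2) = \<sigma>x\<^sup>2 / u0 + \<theta> * (a * \<sigma>x\<^sup>2)"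
      by (simp_all add: f_def u_def u0_def \<kappa>_def add_ac)
    have "\<sigma>x\<^sup>2 / u - \<sigma>x\<^sup>2 / u0 + \<sigma>x\<^sup>2 / u0\<^sup>2 * (u - u0) = \<sigma>x\<^sup>2 / (u * u0\<^sup>2) * (u - u0)\<^sup>2"
      using u u0 by (simp add: field_simps power2_eq_square)
    moreover have "(u - u0)\<^sup>2 = (P - a * \<sigma>x\<^sup>2)\<^sup>2 / \<sigma>v ^ 4"
      using pos by (simp add: u_def u0_def field_simps eval_nat_numeral)
    ultimately have "\<sigma>x\<^sup>2 / u - \<sigma>x\<^sup>2 / u0 + \<sigma>x\<^sup>2 / u0\<^sup>2 * (u - u0)
        = \<sigma>x\<^sup>2 / (u * u0\<^sup>2) / \<sigma>v ^ 4 * (P - a * \<sigma>x\<^sup>2)\<^sup>2"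
      by simp
    then have "f (a * \<sigma>x\<^sup>2) + \<sigma>x\<^sup>2 / (u * u0\<^sup>2) / \<sigma>v ^ 4 * (P - a * \<sigma>x\<^sup>2)\<^sup>2 \<le> f P"
      using fs diff first_order[OF u(1)] by linarith
    moreover have "0 < \<sigma>x\<^sup>2 / (u * u0\<^sup>2) / \<sigma>v ^ 4"
      using u u0 pos by simp
    ultimately show ?thesis by blast
  qed
  show "f (a * \<sigma>x\<^sup>2) \<le> f P" if P: "0 \<le> P"
  proof -
    obtain c where "0 < c" "f (a * \<sigma>x\<^sup>2) + c * (P - a * \<sigma>x\<^sup>2)\<^sup>2 \<le> f P"
      using gap[OF P] by blast
    moreover from this have "0 \<le> c * (P - a * \<sigma>x\<^sup>2)\<^sup>2" by simp
    ultimately show ?thesis by linarith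
  qed
  show "P = a * \<sigma>x\<^sup>2" if P: "0 \<le> P" and le: "f P \<le> f (a * \<sigma>x\<^sup>2)"
  proof -
    obtain c where c: "0 < c" "f (a * \<sigma>x\<^sup>2) + c * (P - a * \<sigma>x\<^sup>2)\<^sup>2 \<le> f P"
      using gap[OF P] by blast
    then have "c * (P - a * \<sigma>x\<^sup>2)\<^sup>2 \<le> 0" using le by linarith
    then show ?thesis using c(1) by (simp add: mult_le_0_iff)
  qed
qed

context combining_game
begin

section \<open>Costs at a best response and the linear pair\<close>

abbreviation mse :: "encoder \<Rightarrow> decoder \<Rightarrow> real" where
  "mse g d \<equiv> (\<integral>\<omega>. (err g d \<omega>)\<^sup>2 \<partial>M)"

lemma decoder_cost_eq_mse:
  "integrable M (\<lambda>\<omega>. (err g d \<omega>)\<^sup>2) \<Longrightarrow> decoder_cost M x v w g d = ennreal (mse g d)"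
  unfolding decoder_cost_def by (rule nn_integral_eq_integral) auto

lemma best_response_mse:
  assumes g: "encoder_strategy M x g" and br: "best_response M x v w g d"
  shows "integrable M (\<lambda>\<omega>. (err g d \<omega>)\<^sup>2)"
    and "\<And>d'. decoder_strategy d' \<Longrightarrow> integrable M (\<lambda>\<omega>. (err g d' \<omega>)\<^sup>2) \<Longrightarrow> mse g d \<le> mse g d'"
proof -
  note [measurable] = encoder_strategyD(1)[OF g]
  have d: "decoder_strategy d"
    and min: "\<And>d'. decoder_strategy d' \<Longrightarrow> decoder_cost M x v w g d \<le> decoder_cost M x v w g d'"
    using br by (auto simp: best_response_def)
  have "decoder_cost M x v w g d \<le> decoder_cost M x v w g (0, \<lambda>_. 0)"
    by (rule min) (simp add: decoder_strategy_def)
  also have "\<dots> = ennreal (mse g (0, \<lambda>_. 0))"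
    by (rule decoder_cost_eq_mse) (simp add: estimate_def x_moments)
  also have "\<dots> < \<infinity>" by simp
  finally have fin: "decoder_cost M x v w g d < \<infinity>" .
  have [measurable]: "snd d \<in> borel_measurable borel"
    using d by (simp add: decoder_strategy_def)
  show int: "integrable M (\<lambda>\<omega>. (err g d \<omega>)\<^sup>2)"
    using fin by (intro integrableI_bounded) (simp_all add: decoder_cost_def)
  show "mse g d \<le> mse g d'" if "decoder_strategy d'" "integrable M (\<lambda>\<omega>. (err g d' \<omega>)\<^sup>2)" for d'
    using min[OF that(1)] unfolding decoder_cost_eq_mse[OF int] decoder_cost_eq_mse[OF that(2)]
    by simp
qed

text \<open>
  Adding a constant to the estimator is an admissible deviation, and adding the mean error would
  lower the cost by its square.
\<close>

lemma best_response_unbiased: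
  assumes g: "encoder_strategy M x g" and br: "best_response M x v w g d"
  shows "integrable M (err g d)" and "(\<integral>\<omega>. err g d \<omega> \<partial>M) = 0"
proof -
  note [measurable] = encoder_strategyD(1)[OF g]
  note sq = best_response_mse(1)[OF g br]
  have d: "decoder_strategy d" using br by (simp add: best_response_def)
  have [measurable]: "snd d \<in> borel_measurable borel"
    using d by (simp add: decoder_strategy_def)
  show int: "integrable M (err g d)"
    by (rule square_integrable_imp_integrable[OF _ sq]) simp
  let ?m = "\<integral>\<omega>. err g d \<omega> \<partial>M"
  define d' where "d' = (fst d, \<lambda>r. snd d r + ?m)"
  have d': "decoder_strategy d'" using d by (simp add: decoder_strategy_def d'_def)
  have sq': "(\<lambda>\<omega>. (err g d' \<omega>)\<^sup>2) = (\<lambda>\<omega>. (err g d \<omega>)\<^sup>2 - 2 * ?m * err g d \<omega> + ?m\<^sup>2)"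
    by (rule ext) (simp add: d'_def estimate_def power2_eq_square algebra_simps)
  have "mse g d \<le> mse g d'"
    by (rule best_response_mse(2)[OF g br d']) (use sq int in \<open>simp add: sq'\<close>)
  also have "mse g d' = mse g d - ?m\<^sup>2"
    unfolding sq' using sq int by (simp add: prob_space power2_eq_square)
  finally show "?m = 0" by simp
qed

text \<open>
  Since the error has mean \<open>0\<close>, the bias contributes the constant \<open>b\<^sup>2\<close>: the conflict of interest
  does not affect the leader's choice.
\<close>

lemma best_response_encoder_cost:
  assumes g: "encoder_strategy M x g" and br: "best_response M x v w g d" and \<theta>: "0 < \<theta>"
  shows "encoder_cost M x v w \<theta> b g d = ennreal (mse g d + \<theta> * power_of g + b\<^sup>2)"
proof -
  note ints = best_response_mse(1)[OF g br] best_response_unbiased[OF g br] encoder_strategyD(2)[OF g]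
  have e: "(\<lambda>\<omega>. (err g d \<omega> - b)\<^sup>2 + \<theta> * (g (x \<omega>))\<^sup>2) =
      (\<lambda>\<omega>. (err g d \<omega>)\<^sup>2 - 2 * b * err g d \<omega> + b\<^sup>2 + \<theta> * (g (x \<omega>))\<^sup>2)"
    by (rule ext) (simp add: power2_eq_square algebra_simps)
  have "encoder_cost M x v w \<theta> b g d = ennreal (\<integral>\<omega>. (err g d \<omega> - b)\<^sup>2 + \<theta> * (g (x \<omega>))\<^sup>2 \<partial>M)"
    unfolding encoder_cost_def
    by (rule nn_integral_eq_integral) (use \<theta> ints in \<open>simp_all add: e\<close>)
  also have "(\<integral>\<omega>. (err g d \<omega> - b)\<^sup>2 + \<theta> * (g (x \<omega>))\<^sup>2 \<partial>M) = mse g d + \<theta> * power_of g + b\<^sup>2"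
    unfolding e using ints by (simp add: prob_space)
  finally show ?thesis .
qed

lemma mse_lower_bound:
  assumes "encoder_strategy M x g" "decoder_strategy d" "integrable M (\<lambda>\<omega>. (err g d \<omega>)\<^sup>2)"
  shows "\<sigma>x\<^sup>2 / snr_sum g \<le> mse g d"
proof -
  have "\<sigma>x\<^sup>2 / snr_sum g * 1 \<le> \<sigma>x\<^sup>2 / snr_sum g * (1 +
     (\<integral>\<omega>. ((1 - fst d) * \<sigma>w\<^sup>2 * g (x \<omega>) - fst d * \<sigma>v\<^sup>2 * x \<omega>)\<^sup>2 \<partial>M) /
        (\<sigma>v\<^sup>2 * \<sigma>w\<^sup>2 * (noise_sd (fst d))\<^sup>2 * snr_sum g))"
    using snr_sum_pos[of g] by (intro mult_left_mono) auto
  also note distortion_bound(2)[OF assms]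
  finally show ?thesis by simp
qed

text \<open>
  Equality forces the mismatch term to vanish, a linear relation between \<open>g x\<close> and \<open>x\<close> that can be
  solved for \<open>g x\<close> because \<open>\<alpha> = 1\<close> would make \<open>x\<close> vanish almost surely.
\<close>

lemma mse_bound_tight_imp_linear:
  assumes g: "encoder_strategy M x g" and d: "decoder_strategy d"
    and int: "integrable M (\<lambda>\<omega>. (err g d \<omega>)\<^sup>2)" and tight: "mse g d \<le> \<sigma>x\<^sup>2 / snr_sum g"
  obtains A where "0 \<le> A" "AE \<omega> in M. g (x \<omega>) = A * x \<omega>" "fst d = A * \<sigma>w\<^sup>2 / (A * \<sigma>w\<^sup>2 + \<sigma>v\<^sup>2)"
proof -
  let ?\<alpha> = "fst d"
  let ?mm = "\<lambda>\<omega>. (1 - ?\<alpha>) * \<sigma>w\<^sup>2 * g (x \<omega>) - ?\<alpha> * \<sigma>v\<^sup>2 * x \<omega>"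
  let ?c = "\<sigma>v\<^sup>2 * \<sigma>w\<^sup>2 * (noise_sd ?\<alpha>)\<^sup>2 * snr_sum g"
  have c: "0 < ?c" using pos snr_sum_pos[of g] noise_sd_pos[of ?\<alpha>] by simp
  have "\<sigma>x\<^sup>2 / snr_sum g * (1 + (\<integral>\<omega>. (?mm \<omega>)\<^sup>2 \<partial>M) / ?c) \<le> \<sigma>x\<^sup>2 / snr_sum g * 1"
    using distortion_bound(2)[OF g d int] tight by simp
  then have "(\<integral>\<omega>. (?mm \<omega>)\<^sup>2 \<partial>M) / ?c \<le> 0"
    using pos snr_sum_pos[of g] by (subst (asm) mult_le_cancel_left_pos) auto
  then have "(\<integral>\<omega>. (?mm \<omega>)\<^sup>2 \<partial>M) \<le> 0"
    using c by (simp add: divide_le_0_iff)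
  then have "(\<integral>\<omega>. (?mm \<omega>)\<^sup>2 \<partial>M) = 0"
    by (intro antisym) auto
  then have proportional: "AE \<omega> in M. (1 - ?\<alpha>) * \<sigma>w\<^sup>2 * g (x \<omega>) = ?\<alpha> * \<sigma>v\<^sup>2 * x \<omega>"
    using integral_nonneg_eq_0_iff_AE[OF distortion_bound(1)[OF g d int]] by simp
  have \<alpha>: "0 \<le> ?\<alpha>" "?\<alpha> \<le> 1" using d by (auto simp: decoder_strategy_def)
  have "?\<alpha> \<noteq> 1"
  proof
    assume "?\<alpha> = 1"
    with proportional pos have "AE \<omega> in M. (x \<omega>)\<^sup>2 = 0" by simp
    then have "(\<integral>\<omega>. (x \<omega>)\<^sup>2 \<partial>M) = 0"
      using integral_nonneg_eq_0_iff_AE[OF x_moments(2)] by simp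
    then show False using x_moments pos by simp
  qed
  with \<alpha> have \<alpha>1: "0 < 1 - ?\<alpha>" by simp
  define A where "A = ?\<alpha> * \<sigma>v\<^sup>2 / ((1 - ?\<alpha>) * \<sigma>w\<^sup>2)"
  show thesis
  proof
    show "0 \<le> A" unfolding A_def using \<alpha> by simp
    show "AE \<omega> in M. g (x \<omega>) = A * x \<omega>"
      using proportional by eventually_elim (use \<alpha>1 pos in \<open>simp add: A_def field_simps\<close>)
    have "A * \<sigma>w\<^sup>2 = ?\<alpha> * \<sigma>v\<^sup>2 / (1 - ?\<alpha>)" "A * \<sigma>w\<^sup>2 + \<sigma>v\<^sup>2 = \<sigma>v\<^sup>2 / (1 - ?\<alpha>)"
      unfolding A_def using \<alpha>1 pos by (simp_all add: field_simps)
    then show "?\<alpha> = A * \<sigma>w\<^sup>2 / (A * \<sigma>w\<^sup>2 + \<sigma>v\<^sup>2)"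
      using \<alpha>1 pos by simp
  qed
qed

text \<open>
  The error of the linear decoder is a combination of the independent variables \<open>x\<close> and \<open>noise\<close>.
  Below, \<open>B / e\<close> is the gain from \<open>x\<close> to the received signal and \<open>Q\<close> the denominator of \<open>K\<close>.
\<close>

lemma linear_mse:
  fixes A :: real
  assumes A: "0 \<le> A"
    and \<alpha>: "\<alpha> = A * \<sigma>w\<^sup>2 / (A * \<sigma>w\<^sup>2 + \<sigma>v\<^sup>2)"
    and K: "K = (A * \<sigma>x\<^sup>2 * \<sigma>w\<^sup>2 + \<sigma>x\<^sup>2 * \<sigma>v\<^sup>2)
            / (A\<^sup>2 * \<sigma>x\<^sup>2 * \<sigma>w\<^sup>2 + \<sigma>x\<^sup>2 * \<sigma>v\<^sup>2 + \<sigma>w\<^sup>2 * \<sigma>v\<^sup>2)"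
  shows "decoder_strategy (\<alpha>, \<lambda>r. K * r)"
    and "integrable M (\<lambda>\<omega>. (err (\<lambda>t. A * t) (\<alpha>, \<lambda>r. K * r) \<omega>)\<^sup>2)"
    and "mse (\<lambda>t. A * t) (\<alpha>, \<lambda>r. K * r) = \<sigma>x\<^sup>2 / snr_sum (\<lambda>t. A * t)"
proof -
  define e B Q where "e = A * \<sigma>w\<^sup>2 + \<sigma>v\<^sup>2" and "B = A\<^sup>2 * \<sigma>w\<^sup>2 + \<sigma>v\<^sup>2" and "Q = B * \<sigma>x\<^sup>2 + \<sigma>w\<^sup>2 * \<sigma>v\<^sup>2"
  have e: "0 < e" and B: "0 < B"
    unfolding e_def B_def using A pos by (auto intro!: add_nonneg_pos)
  have Q: "0 < Q" unfolding Q_def using B pos by (auto intro!: add_pos_pos)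
  have \<alpha>': "\<alpha> = A * \<sigma>w\<^sup>2 / e"
    by (simp add: \<alpha> e_def)
  have "1 - \<alpha> = (e - A * \<sigma>w\<^sup>2) / e"
    unfolding \<alpha>' using e by (simp add: diff_divide_distrib)
  also have "\<dots> = \<sigma>v\<^sup>2 / e" by (simp add: e_def)
  finally have \<alpha>'': "1 - \<alpha> = \<sigma>v\<^sup>2 / e" .
  have K': "K = \<sigma>x\<^sup>2 * e / Q" unfolding K e_def Q_def B_def by (simp add: algebra_simps)
  show "decoder_strategy (\<alpha>, \<lambda>r. K * r)"
    using A e \<alpha>' pos by (simp add: decoder_strategy_def e_def pos_divide_le_eq)
  have N2: "integrable M (\<lambda>\<omega>. (noise \<alpha> \<omega>)\<^sup>2)" "(\<integral>\<omega>. (noise \<alpha> \<omega>)\<^sup>2 \<partial>M) = (noise_sd \<alpha>)\<^sup>2"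
    "integrable M (noise \<alpha>)" "(\<integral>\<omega>. noise \<alpha> \<omega> \<partial>M) = 0"
    using centered_normal_integrable_square[OF noise_sd_pos noise_normal]
      centered_normal_second_moment[OF noise_sd_pos noise_normal]
      centered_normal_integrable[OF noise_sd_pos noise_normal]
      normal_distributed_expectation[OF noise_sd_pos noise_normal] by auto
  have cross: "integrable M (\<lambda>\<omega>. x \<omega> * noise \<alpha> \<omega>)" "(\<integral>\<omega>. x \<omega> * noise \<alpha> \<omega> \<partial>M) = 0"
    using indep_var_integrable[OF indep_noise x_moments(1) N2(3)]
      indep_var_lebesgue_integral[OF indep_noise x_moments(1) N2(3)] N2(4) by auto
  define c where "c = 1 - K * (\<alpha> * A + (1 - \<alpha>))"
  have eq: "(\<lambda>\<omega>. (err (\<lambda>t. A * t) (\<alpha>, \<lambda>r. K * r) \<omega>)\<^sup>2) =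
     (\<lambda>\<omega>. c\<^sup>2 * (x \<omega>)\<^sup>2 - 2 * c * K * (x \<omega> * noise \<alpha> \<omega>) + K\<^sup>2 * (noise \<alpha> \<omega>)\<^sup>2)"
    by (rule ext) (simp add: c_def estimate_def received_eq mix_def power2_eq_square algebra_simps)
  show "integrable M (\<lambda>\<omega>. (err (\<lambda>t. A * t) (\<alpha>, \<lambda>r. K * r) \<omega>)\<^sup>2)"
    unfolding eq using cross N2 x_moments by simp
  have "mse (\<lambda>t. A * t) (\<alpha>, \<lambda>r. K * r) = c\<^sup>2 * \<sigma>x\<^sup>2 + K\<^sup>2 * (noise_sd \<alpha>)\<^sup>2"
    unfolding eq using cross N2 x_moments by simp
  also have "c = \<sigma>w\<^sup>2 * \<sigma>v\<^sup>2 / Q"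
  proof -
    have "\<alpha> * A + (1 - \<alpha>) = B / e"
      unfolding \<alpha>'' unfolding \<alpha>' B_def by (simp add: add_divide_distrib power2_eq_square mult_ac)
    then have "c = 1 - \<sigma>x\<^sup>2 * B / Q"
      unfolding c_def K' using e by simp
    also have "\<dots> = \<sigma>w\<^sup>2 * \<sigma>v\<^sup>2 / Q"
      using Q by (simp add: Q_def field_simps)
    finally show ?thesis .
  qed
  also have "(noise_sd \<alpha>)\<^sup>2 = \<sigma>v\<^sup>2 * \<sigma>w\<^sup>2 * B / e\<^sup>2"
    unfolding noise_sd_square \<alpha>'' unfolding \<alpha>' B_def by (simp add: add_divide_distrib power_divide power_mult_distrib)
      (simp add: power2_eq_square power4_eq_xxxx algebra_simps add_divide_distrib)
  also have "(\<sigma>w\<^sup>2 * \<sigma>v\<^sup>2 / Q)\<^sup>2 * \<sigma>x\<^sup>2 + K\<^sup>2 * (\<sigma>v\<^sup>2 * \<sigma>w\<^sup>2 * B / e\<^sup>2) = \<sigma>x\<^sup>2 * \<sigma>w\<^sup>2 * \<sigma>v\<^sup>2 * Q / Q\<^sup>2"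
    unfolding K' using e by (simp add: power_divide power_mult_distrib flip: add_divide_distrib)
      (simp add: Q_def power2_eq_square power4_eq_xxxx algebra_simps)
  also have "\<dots> = \<sigma>x\<^sup>2 * (\<sigma>w\<^sup>2 * \<sigma>v\<^sup>2) / Q"
    using Q by (simp add: power2_eq_square)
  also have "\<dots> = \<sigma>x\<^sup>2 / snr_sum (\<lambda>t. A * t)"
  proof -
    have "snr_sum (\<lambda>t. A * t) = Q / (\<sigma>w\<^sup>2 * \<sigma>v\<^sup>2)"
      unfolding snr_sum_def power_linear Q_def B_def using pos by (simp add: field_simps)
    then show ?thesis by simp
  qed
  finally show "mse (\<lambda>t. A * t) (\<alpha>, \<lambda>r. K * r) = \<sigma>x\<^sup>2 / snr_sum (\<lambda>t. A * t)" .
qed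

text \<open>
  By the parallelogram law the average of the two estimators beats their common error by a quarter
  of their mean squared difference, while no estimator beats the bound.
\<close>

lemma tight_estimators_agree:
  assumes g: "encoder_strategy M x g"
    and h: "decoder_strategy (\<alpha>, h)" "integrable M (\<lambda>\<omega>. (err g (\<alpha>, h) \<omega>)\<^sup>2)"
      "mse g (\<alpha>, h) \<le> \<sigma>x\<^sup>2 / snr_sum g"
    and k: "decoder_strategy (\<alpha>, k)" "integrable M (\<lambda>\<omega>. (err g (\<alpha>, k) \<omega>)\<^sup>2)"
      "mse g (\<alpha>, k) \<le> \<sigma>x\<^sup>2 / snr_sum g"
  shows "AE \<omega> in M. h (received x v w g \<alpha> \<omega>) = k (received x v w g \<alpha> \<omega>)"
proof -
  note [measurable] = encoder_strategyD(1)[OF g]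
  have [measurable]: "h \<in> borel_measurable borel" "k \<in> borel_measurable borel"
    using h k by (auto simp: decoder_strategy_def)
  let ?r = "received x v w g \<alpha>"
  define m where "m r = (h r + k r) / 2" for r
  have m: "decoder_strategy (\<alpha>, m)"
    using h(1) by (simp add: decoder_strategy_def m_def[abs_def])
  have prod: "integrable M (\<lambda>\<omega>. err g (\<alpha>, h) \<omega> * err g (\<alpha>, k) \<omega>)"
    by (rule integrable_mult_of_squares) (use h k measurable_err[of g "(\<alpha>, _)"] in simp_all)
  have diff: "(\<lambda>\<omega>. (h (?r \<omega>) - k (?r \<omega>))\<^sup>2) =
      (\<lambda>\<omega>. (err g (\<alpha>, h) \<omega>)\<^sup>2 + (err g (\<alpha>, k) \<omega>)\<^sup>2 - 2 * (err g (\<alpha>, h) \<omega> * err g (\<alpha>, k) \<omega>))"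
    by (rule ext) (simp add: estimate_def power2_eq_square algebra_simps)
  have diff_int: "integrable M (\<lambda>\<omega>. (h (?r \<omega>) - k (?r \<omega>))\<^sup>2)"
    unfolding diff using h k prod by simp
  have mid: "(\<lambda>\<omega>. (err g (\<alpha>, m) \<omega>)\<^sup>2) =
      (\<lambda>\<omega>. (err g (\<alpha>, h) \<omega>)\<^sup>2 / 2 + (err g (\<alpha>, k) \<omega>)\<^sup>2 / 2 - (h (?r \<omega>) - k (?r \<omega>))\<^sup>2 / 4)"
    by (rule ext) (simp add: m_def estimate_def power2_eq_square field_simps)
  have "\<sigma>x\<^sup>2 / snr_sum g \<le> mse g (\<alpha>, m)"
    by (rule mse_lower_bound[OF g m]) (use h k diff_int in \<open>simp add: mid\<close>)
  also have "\<dots> = mse g (\<alpha>, h) / 2 + mse g (\<alpha>, k) / 2 - (\<integral>\<omega>. (h (?r \<omega>) - k (?r \<omega>))\<^sup>2 \<partial>M) / 4"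
    unfolding mid using h k diff_int by simp
  finally have "(\<integral>\<omega>. (h (?r \<omega>) - k (?r \<omega>))\<^sup>2 \<partial>M) \<le> 0"
    using h(3) k(3) by linarith
  then have "(\<integral>\<omega>. (h (?r \<omega>) - k (?r \<omega>))\<^sup>2 \<partial>M) = 0"
    by (intro antisym) auto
  then show ?thesis
    using integral_nonneg_eq_0_iff_AE[OF diff_int] by simp
qed

section \<open>The equilibrium\<close>

definition optimal_gain :: "real \<Rightarrow> real \<Rightarrow> bool" where
  "optimal_gain \<theta> A \<longleftrightarrow> 0 \<le> A \<and>
     A\<^sup>2 = (if \<theta> < \<sigma>x\<^sup>2 / (\<sigma>v\<^sup>2 * (\<sigma>x\<^sup>2 / \<sigma>w\<^sup>2 + 1)\<^sup>2)
            then sqrt (\<sigma>v\<^sup>2 / (\<theta> * \<sigma>x\<^sup>2)) - \<sigma>v\<^sup>2 / \<sigma>x\<^sup>2 * (\<sigma>x\<^sup>2 / \<sigma>w\<^sup>2 + 1)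
            else 0)"

lemma optimal_gain_exists:
  assumes "0 < \<theta>"
  obtains A where "optimal_gain \<theta> A"
proof -
  let ?a = "if \<theta> < \<sigma>x\<^sup>2 / (\<sigma>v\<^sup>2 * (\<sigma>x\<^sup>2 / \<sigma>w\<^sup>2 + 1)\<^sup>2)
            then sqrt (\<sigma>v\<^sup>2 / (\<theta> * \<sigma>x\<^sup>2)) - \<sigma>v\<^sup>2 / \<sigma>x\<^sup>2 * (\<sigma>x\<^sup>2 / \<sigma>w\<^sup>2 + 1)
            else 0"
  have "0 \<le> ?a"
    by (rule power_distortion_tradeoff(1)[OF pos assms refl])
  then have "optimal_gain \<theta> (sqrt ?a)"
    unfolding optimal_gain_def by (intro conjI real_sqrt_ge_zero real_sqrt_pow2)
  then show thesis by (rule that)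
qed

lemma optimal_gain_tradeoff:
  assumes \<theta>: "0 < \<theta>" and A: "optimal_gain \<theta> A"
  shows "\<sigma>x\<^sup>2 / snr_sum (\<lambda>t. A * t) + \<theta> * (A\<^sup>2 * \<sigma>x\<^sup>2) \<le> \<sigma>x\<^sup>2 / snr_sum g + \<theta> * power_of g"
    and "\<sigma>x\<^sup>2 / snr_sum g + \<theta> * power_of g \<le> \<sigma>x\<^sup>2 / snr_sum (\<lambda>t. A * t) + \<theta> * (A\<^sup>2 * \<sigma>x\<^sup>2)
      \<Longrightarrow> power_of g = A\<^sup>2 * \<sigma>x\<^sup>2"
proof -
  note A2 = conjunct2[OF A[unfolded optimal_gain_def]]
  have P: "0 \<le> power_of g" by simp
  note * = power_distortion_tradeoff(2,3)[OF pos \<theta> A2 P]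
  show "\<sigma>x\<^sup>2 / snr_sum (\<lambda>t. A * t) + \<theta> * (A\<^sup>2 * \<sigma>x\<^sup>2) \<le> \<sigma>x\<^sup>2 / snr_sum g + \<theta> * power_of g"
    unfolding snr_sum_def power_linear by (rule *(1))
  show "power_of g = A\<^sup>2 * \<sigma>x\<^sup>2"
    if "\<sigma>x\<^sup>2 / snr_sum g + \<theta> * power_of g \<le> \<sigma>x\<^sup>2 / snr_sum (\<lambda>t. A * t) + \<theta> * (A\<^sup>2 * \<sigma>x\<^sup>2)"
    using that unfolding snr_sum_def power_linear by (rule *(2))
qed

lemma best_response_to_linear_mse:
  assumes A: "0 \<le> A" and br: "best_response M x v w (\<lambda>t. A * t) d"
  shows "mse (\<lambda>t. A * t) d = \<sigma>x\<^sup>2 / snr_sum (\<lambda>t. A * t)"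
proof (rule antisym)
  show "mse (\<lambda>t. A * t) d \<le> \<sigma>x\<^sup>2 / snr_sum (\<lambda>t. A * t)"
    using best_response_mse(2)[OF linear_encoder br linear_mse(1,2)[OF A refl refl]]
    unfolding linear_mse(3)[OF A refl refl] .
  show "\<sigma>x\<^sup>2 / snr_sum (\<lambda>t. A * t) \<le> mse (\<lambda>t. A * t) d"
    using br by (intro mse_lower_bound linear_encoder best_response_mse[OF linear_encoder br])
      (simp add: best_response_def)
qed

lemma linear_best_response:
  assumes A: "0 \<le> A"
    and \<alpha>: "\<alpha> = A * \<sigma>w\<^sup>2 / (A * \<sigma>w\<^sup>2 + \<sigma>v\<^sup>2)"
    and K: "K = (A * \<sigma>x\<^sup>2 * \<sigma>w\<^sup>2 + \<sigma>x\<^sup>2 * \<sigma>v\<^sup>2)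
            / (A\<^sup>2 * \<sigma>x\<^sup>2 * \<sigma>w\<^sup>2 + \<sigma>x\<^sup>2 * \<sigma>v\<^sup>2 + \<sigma>w\<^sup>2 * \<sigma>v\<^sup>2)"
  shows "best_response M x v w (\<lambda>t. A * t) (\<alpha>, \<lambda>r. K * r)"
proof -
  note lin = linear_mse[OF A \<alpha> K]
  obtain d where d: "best_response M x v w (\<lambda>t. A * t) d"
    using best_response_exists[OF linear_encoder] by blast
  have "decoder_cost M x v w (\<lambda>t. A * t) (\<alpha>, \<lambda>r. K * r) = decoder_cost M x v w (\<lambda>t. A * t) d"
    using decoder_cost_eq_mse[OF lin(2)] decoder_cost_eq_mse[OF best_response_mse(1)[OF linear_encoder d]]
      lin(3) best_response_to_linear_mse[OF A d] by simp
  with d lin(1) show ?thesis by (simp add: best_response_def)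
qed

lemma linear_equilibrium_exists:
  assumes \<theta>: "0 < \<theta>" and A: "optimal_gain \<theta> A"
    and \<alpha>: "\<alpha> = A * \<sigma>w\<^sup>2 / (A * \<sigma>w\<^sup>2 + \<sigma>v\<^sup>2)"
    and K: "K = (A * \<sigma>x\<^sup>2 * \<sigma>w\<^sup>2 + \<sigma>x\<^sup>2 * \<sigma>v\<^sup>2)
            / (A\<^sup>2 * \<sigma>x\<^sup>2 * \<sigma>w\<^sup>2 + \<sigma>x\<^sup>2 * \<sigma>v\<^sup>2 + \<sigma>w\<^sup>2 * \<sigma>v\<^sup>2)"
  shows "\<exists>R. stackelberg_equilibrium M x v w \<theta> b (\<lambda>t. A * t) R \<and> R (\<lambda>t. A * t) = (\<alpha>, \<lambda>r. K * r)"
proof -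
  have A0: "0 \<le> A" using A by (simp add: optimal_gain_def)
  define R where "R = (\<lambda>g. SOME d. best_response M x v w g d)((\<lambda>t. A * t) := (\<alpha>, \<lambda>r. K * r))"
  have R: "best_response M x v w g (R g)" if "encoder_strategy M x g" for g
    using linear_best_response[OF A0 \<alpha> K] someI_ex[OF best_response_exists[OF that]]
    by (simp add: R_def)
  have "encoder_cost M x v w \<theta> b (\<lambda>t. A * t) (R (\<lambda>t. A * t)) \<le> encoder_cost M x v w \<theta> b g (R g)"
    if g: "encoder_strategy M x g" for g
  proof -
    have "\<sigma>x\<^sup>2 / snr_sum g \<le> mse g (R g)"
      using R[OF g] best_response_mse(1)[OF g R[OF g]]
      by (intro mse_lower_bound g) (simp_all add: best_response_def)
    then show ?thesis
      unfolding best_response_encoder_cost[OF g R[OF g] \<theta>]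
        best_response_encoder_cost[OF linear_encoder R[OF linear_encoder] \<theta>]
        best_response_to_linear_mse[OF A0 R[OF linear_encoder]] power_linear
      using optimal_gain_tradeoff(1)[OF \<theta> A, of g] by (intro ennreal_leI) linarith
  qed
  with R linear_encoder show ?thesis
    by (intro exI[of _ R]) (simp add: stackelberg_equilibrium_def R_def)
qed

text \<open>
  Deviating to the linear encoder squeezes the leader's cost between its value there and the lower
  bound. Every inequality in between is then an equality, which determines first the power, then
  the shape of the encoder and the combining parameter, and last the estimator.
\<close>

lemma equilibrium_is_linear:
  assumes \<theta>: "0 < \<theta>" and A: "optimal_gain \<theta> A"
    and \<alpha>: "\<alpha> = A * \<sigma>w\<^sup>2 / (A * \<sigma>w\<^sup>2 + \<sigma>v\<^sup>2)"
    and K: "K = (A * \<sigma>x\<^sup>2 * \<sigma>w\<^sup>2 + \<sigma>x\<^sup>2 * \<sigma>v\<^sup>2)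
            / (A\<^sup>2 * \<sigma>x\<^sup>2 * \<sigma>w\<^sup>2 + \<sigma>x\<^sup>2 * \<sigma>v\<^sup>2 + \<sigma>w\<^sup>2 * \<sigma>v\<^sup>2)"
    and eq: "stackelberg_equilibrium M x v w \<theta> b g R"
  shows "AE \<omega> in M. g (x \<omega>) = A * x \<omega>"
    and "fst (R g) = \<alpha>"
    and "AE \<omega> in M. snd (R g) (received x v w g \<alpha> \<omega>) = K * received x v w g \<alpha> \<omega>"
    and "mse g (R g) = \<sigma>x\<^sup>2 / snr_sum (\<lambda>t. A * t)"
    and "power_of g = A\<^sup>2 * \<sigma>x\<^sup>2"
proof -
  have A0: "0 \<le> A" using A by (simp add: optimal_gain_def)
  let ?lin = "\<lambda>t. A * t"
  have g: "encoder_strategy M x g" and R: "\<And>g. encoder_strategy M x g \<Longrightarrow> best_response M x v w g (R g)"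
    and le: "encoder_cost M x v w \<theta> b g (R g) \<le> encoder_cost M x v w \<theta> b ?lin (R ?lin)"
    using eq linear_encoder by (auto simp: stackelberg_equilibrium_def)
  note [measurable] = encoder_strategyD(1)[OF g]
  have d: "decoder_strategy (R g)" using R[OF g] by (simp add: best_response_def)
  note int = best_response_mse(1)[OF g R[OF g]]
  note lower = mse_lower_bound[OF g d int]
  have "0 \<le> \<sigma>x\<^sup>2 / snr_sum ?lin + \<theta> * (A\<^sup>2 * \<sigma>x\<^sup>2) + b\<^sup>2"
    using snr_sum_pos[of ?lin] \<theta> by simp
  then have J: "mse g (R g) + \<theta> * power_of g \<le> \<sigma>x\<^sup>2 / snr_sum ?lin + \<theta> * (A\<^sup>2 * \<sigma>x\<^sup>2)"
    using le unfolding best_response_encoder_cost[OF g R[OF g] \<theta>]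
      best_response_encoder_cost[OF linear_encoder R[OF linear_encoder] \<theta>]
      best_response_to_linear_mse[OF A0 R[OF linear_encoder]] power_linear
    by simp
  show power: "power_of g = A\<^sup>2 * \<sigma>x\<^sup>2"
    using J lower by (intro optimal_gain_tradeoff(2)[OF \<theta> A]) linarith
  then have snr: "snr_sum ?lin = snr_sum g"
    unfolding snr_sum_def power_linear by simp
  have tight: "mse g (R g) \<le> \<sigma>x\<^sup>2 / snr_sum g"
    using J unfolding power snr by simp
  then show "mse g (R g) = \<sigma>x\<^sup>2 / snr_sum ?lin"
    using lower snr by simp
  obtain A' where A': "0 \<le> A'" "AE \<omega> in M. g (x \<omega>) = A' * x \<omega>"
      "fst (R g) = A' * \<sigma>w\<^sup>2 / (A' * \<sigma>w\<^sup>2 + \<sigma>v\<^sup>2)"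
    by (rule mse_bound_tight_imp_linear[OF g d int tight])
  have "power_of g = power_of (\<lambda>t. A' * t)"
    using A'(2) by (intro integral_cong_AE) auto
  then have "A' = A"
    using power power_linear[of A'] pos A' A0 by simp
  with A' \<alpha> show AE: "AE \<omega> in M. g (x \<omega>) = A * x \<omega>" and fst: "fst (R g) = \<alpha>"
    by auto
  note lin = linear_mse[OF A0 \<alpha> K]
  have same: "AE \<omega> in M. (err g (\<alpha>, \<lambda>r. K * r) \<omega>)\<^sup>2 = (err ?lin (\<alpha>, \<lambda>r. K * r) \<omega>)\<^sup>2"
    using AE by eventually_elim (simp add: estimate_def received_def)
  have [measurable]: "err g (\<alpha>, \<lambda>r. K * r) \<in> borel_measurable M" "err ?lin (\<alpha>, \<lambda>r. K * r) \<in> borel_measurable M"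
    by (rule measurable_err; simp)+
  have meas: "(\<lambda>\<omega>. (err g (\<alpha>, \<lambda>r. K * r) \<omega>)\<^sup>2) \<in> borel_measurable M"
     "(\<lambda>\<omega>. (err ?lin (\<alpha>, \<lambda>r. K * r) \<omega>)\<^sup>2) \<in> borel_measurable M"
    by measurable
  have Kint: "integrable M (\<lambda>\<omega>. (err g (\<alpha>, \<lambda>r. K * r) \<omega>)\<^sup>2)"
    using lin(2) unfolding integrable_cong_AE[OF meas same] .
  have Kmse: "mse g (\<alpha>, \<lambda>r. K * r) \<le> \<sigma>x\<^sup>2 / snr_sum g"
    unfolding integral_cong_AE[OF meas same] lin(3) snr ..
  have Rg: "R g = (\<alpha>, snd (R g))" using fst by (metis prod.collapse)
  show "AE \<omega> in M. snd (R g) (received x v w g \<alpha> \<omega>) = K * received x v w g \<alpha> \<omega>"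
    using d int tight by (intro tight_estimators_agree[OF g _ _ _ lin(1) Kint Kmse]) (simp_all only: Rg[symmetric])
qed

end

theorem mainTheorem3:
  fixes M :: "'a measure" and x v w :: "'a \<Rightarrow> real"
    and \<sigma>x \<sigma>v \<sigma>w \<theta> b :: real
  assumes "prob_space M"
    and "\<sigma>x > 0" and "\<sigma>v > 0" and "\<sigma>w > 0"
    and "distributed M lborel x (normal_density 0 \<sigma>x)"
    and "distributed M lborel v (normal_density 0 \<sigma>v)"
    and "distributed M lborel w (normal_density 0 \<sigma>w)"
    and "prob_space.indep_vars M (\<lambda>_. borel) (\<lambda>i. [x, v, w] ! i) {..<3}"
    and "\<theta> > 0"
  shows "\<exists>A \<alpha> K Jd :: real.
      A \<ge> 0 \<and> K \<ge> 0 \<and>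
      A\<^sup>2 = (if \<theta> < \<sigma>x\<^sup>2 / (\<sigma>v\<^sup>2 * (\<sigma>x\<^sup>2 / \<sigma>w\<^sup>2 + 1)\<^sup>2)
            then sqrt (\<sigma>v\<^sup>2 / (\<theta> * \<sigma>x\<^sup>2)) - \<sigma>v\<^sup>2 / \<sigma>x\<^sup>2 * (\<sigma>x\<^sup>2 / \<sigma>w\<^sup>2 + 1)
            else 0) \<and>
      \<alpha> = A * \<sigma>w\<^sup>2 / (A * \<sigma>w\<^sup>2 + \<sigma>v\<^sup>2) \<and>
      K = (A * \<sigma>x\<^sup>2 * \<sigma>w\<^sup>2 + \<sigma>x\<^sup>2 * \<sigma>v\<^sup>2)
            / (A\<^sup>2 * \<sigma>x\<^sup>2 * \<sigma>w\<^sup>2 + \<sigma>x\<^sup>2 * \<sigma>v\<^sup>2 + \<sigma>w\<^sup>2 * \<sigma>v\<^sup>2) \<and>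
      Jd = \<sigma>x\<^sup>2 * \<sigma>w\<^sup>2 * \<sigma>v\<^sup>2 / ((A\<^sup>2 * \<sigma>w\<^sup>2 + \<sigma>v\<^sup>2) * \<sigma>x\<^sup>2 + \<sigma>w\<^sup>2 * \<sigma>v\<^sup>2) \<and>
      (\<exists>R. stackelberg_equilibrium M x v w \<theta> b (\<lambda>t. A * t) R \<and>
           R (\<lambda>t. A * t) = (\<alpha>, \<lambda>r. K * r)) \<and>
      (\<forall>\<gamma>e R. stackelberg_equilibrium M x v w \<theta> b \<gamma>e R \<longrightarrow>
           (AE \<omega> in M. \<gamma>e (x \<omega>) = A * x \<omega>) \<and>
           fst (R \<gamma>e) = \<alpha> \<and>
           (AE \<omega> in M. snd (R \<gamma>e) (received x v w \<gamma>e \<alpha> \<omega>) = K * received x v w \<gamma>e \<alpha> \<omega>) \<and>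
           decoder_cost M x v w \<gamma>e (R \<gamma>e) = ennreal Jd \<and>
           encoder_cost M x v w \<theta> b \<gamma>e (R \<gamma>e) = ennreal (Jd + \<theta> * A\<^sup>2 * \<sigma>x\<^sup>2 + b\<^sup>2))"
proof -
  interpret combining_game M x v w \<sigma>x \<sigma>v \<sigma>w
    using assms by (intro combining_game.intro combining_game_axioms.intro)
  obtain A where A: "optimal_gain \<theta> A"
    using optimal_gain_exists[OF \<open>0 < \<theta>\<close>] .
  then have A0: "0 \<le> A" by (simp add: optimal_gain_def)
  define \<alpha> K Jd where "\<alpha> = A * \<sigma>w\<^sup>2 / (A * \<sigma>w\<^sup>2 + \<sigma>v\<^sup>2)"
    and "K = (A * \<sigma>x\<^sup>2 * \<sigma>w\<^sup>2 + \<sigma>x\<^sup>2 * \<sigma>v\<^sup>2)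
            / (A\<^sup>2 * \<sigma>x\<^sup>2 * \<sigma>w\<^sup>2 + \<sigma>x\<^sup>2 * \<sigma>v\<^sup>2 + \<sigma>w\<^sup>2 * \<sigma>v\<^sup>2)"
    and "Jd = \<sigma>x\<^sup>2 * \<sigma>w\<^sup>2 * \<sigma>v\<^sup>2 / ((A\<^sup>2 * \<sigma>w\<^sup>2 + \<sigma>v\<^sup>2) * \<sigma>x\<^sup>2 + \<sigma>w\<^sup>2 * \<sigma>v\<^sup>2)"
  have K0: "0 \<le> K" unfolding K_def using A0 by simp
  have "snr_sum (\<lambda>t. A * t) = ((A\<^sup>2 * \<sigma>w\<^sup>2 + \<sigma>v\<^sup>2) * \<sigma>x\<^sup>2 + \<sigma>w\<^sup>2 * \<sigma>v\<^sup>2) / (\<sigma>w\<^sup>2 * \<sigma>v\<^sup>2)"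
    unfolding snr_sum_def power_linear using pos by (simp add: field_simps)
  then have Jd: "\<sigma>x\<^sup>2 / snr_sum (\<lambda>t. A * t) = Jd"
    by (simp add: Jd_def)
  have unique: "\<forall>g R. stackelberg_equilibrium M x v w \<theta> b g R \<longrightarrow>
      (AE \<omega> in M. g (x \<omega>) = A * x \<omega>) \<and> fst (R g) = \<alpha> \<and>
      (AE \<omega> in M. snd (R g) (received x v w g \<alpha> \<omega>) = K * received x v w g \<alpha> \<omega>) \<and>
      decoder_cost M x v w g (R g) = ennreal Jd \<and>
      encoder_cost M x v w \<theta> b g (R g) = ennreal (Jd + \<theta> * A\<^sup>2 * \<sigma>x\<^sup>2 + b\<^sup>2)"
  proof (intro allI impI)
    fix g R assume eq: "stackelberg_equilibrium M x v w \<theta> b g R"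
    note lin = equilibrium_is_linear[OF \<open>0 < \<theta>\<close> A \<alpha>_def K_def eq]
    have g: "encoder_strategy M x g" and br: "best_response M x v w g (R g)"
      using eq by (auto simp: stackelberg_equilibrium_def)
    have "decoder_cost M x v w g (R g) = ennreal Jd"
      using decoder_cost_eq_mse[OF best_response_mse(1)[OF g br]] lin(4) Jd by simp
    moreover have "encoder_cost M x v w \<theta> b g (R g) = ennreal (Jd + \<theta> * A\<^sup>2 * \<sigma>x\<^sup>2 + b\<^sup>2)"
      unfolding best_response_encoder_cost[OF g br \<open>0 < \<theta>\<close>] lin(4,5) Jd by (simp only: mult.assoc)
    ultimately show "(AE \<omega> in M. g (x \<omega>) = A * x \<omega>) \<and> fst (R g) = \<alpha> \<and>
      (AE \<omega> in M. snd (R g) (received x v w g \<alpha> \<omega>) = K * received x v w g \<alpha> \<omega>) \<and>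
      decoder_cost M x v w g (R g) = ennreal Jd \<and>
      encoder_cost M x v w \<theta> b g (R g) = ennreal (Jd + \<theta> * A\<^sup>2 * \<sigma>x\<^sup>2 + b\<^sup>2)"
      using lin by blast
  qed
  show ?thesis
    by (rule exI[of _ A], rule exI[of _ \<alpha>], rule exI[of _ K], rule exI[of _ Jd], intro conjI)
      (rule A0 K0 conjunct2[OF A[unfolded optimal_gain_def]] \<alpha>_def K_def Jd_def
        linear_equilibrium_exists[OF \<open>0 < \<theta>\<close> A \<alpha>_def K_def] unique)+
qed

end
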